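(* Let $n\ge2$, $\gamma\in\mathbb{C}\setminus\{0\}$, $f_0\in\mathbb{C}$ a constant, $\sigma=\sum_{k=1}^n\lambda_k$, and let $f=f(\lambda)\not\equiv0$ be a meromorphic function that is $\gamma$-periodic in each $\lambda_i$. Let $$K_{ij}(u;\lambda)=f\left(\frac{1}{f-\lambda_{ij}}-\frac1u\right)\prod_{a\neq j}\left(1+\frac{f}{\lambda_{ja}}\right),\qquad i,j=1,\dots,n,$$ and let $b(u;\lambda)$ be the $n\times n$ matrix with $$b_{ij}=\frac{\lambda_j^{\,i-1}}{\prod_{a\neq j}\lambda_{ja}}\ (1\le i\le n-1),\qquad b_{nj}=\frac{\lambda_j^{\,n-1}(\sigma-\lambda_j+u+\gamma)}{(\sigma+u+f_0)\prod_{a\neq j}\lambda_{ja}}.$$ Put $b^g(u;\lambda)=b(u-\gamma;\lambda)$. Then $K(u;\lambda)=b^g(u;\lambda)^{-1}\,Q(u;\lambda)\,b^g(u;\lambda)$, where $Q$ is the lower triangular matrix $$Q=\sum_{i=1}^{n-1}e_{ii}+\left(1-\frac{n f}{u}\right)e_{nn}+\sum_{1\le j<i\le n-1}\binom{i-1}{i-j}f^{\,i-j}\,e_{ij}+\sum_{j=1}^{n-1}\frac{M_{nj}}{u\,(u+\sigma-\gamma+f_0)}\,e_{nj},$$ $$M_{nj}=\binom{n-1}{n-j}f^{\,n-j}\,u(u+\sigma)-\binom{n}{n-j+1}f^{\,n-j+1}\,u+(-1)^{n-j+1}\,n f\sum_{\beta\in\mathcal{L}_{nj}}\ \prod_{i\in\beta}\lambda_i,$$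 and $\mathcal{L}_{nj}$ is the set of all subsets $\beta\subset\{1,\dots,n\}$ with $n-j+1$ elements.
   Context: $\lambda=(\lambda_1,\dots,\lambda_n)$ are complex variables, $\lambda_{ij}=\lambda_i-\lambda_j$, $u$ is a complex spectral parameter, and $e_{ij}$ are the standard $n\times n$ matrix units. The identity holds as an identity of meromorphic functions of $(u,\lambda)$. Here $f$ is treated as a given function of $\lambda$, and no shift of $\lambda$ occurs in the definition of $b^g$ (only $u\mapsto u-\gamma$). *)

theory Defs
  imports "HOL-Analysis.Analysis"
begin

section \<open>Meromorphic functions of several complex variables\<close>

text \<open>Complex differentiability at every point of \<open>S\<close> (used for open \<open>S\<close>): the
  Frechet derivative exists and is complex linear.\<close>

definition holomorphic_sv :: "(complex ^ 'm \<Rightarrow> complex) \<Rightarrow> (complex ^ 'm) set \<Rightarrow> bool" where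
  "holomorphic_sv F S \<longleftrightarrow>
     (\<forall>z\<in>S. \<exists>c :: complex ^ 'm. (F has_derivative (\<lambda>h. \<Sum>i\<in>UNIV. c $ i * h $ i)) (at z within S))"

text \<open>A property holds generically if, near every point, it can only fail on the zero set of a
  holomorphic function that does not vanish identically. In particular it holds on a dense set.\<close>

definition generically :: "(complex ^ 'm \<Rightarrow> bool) \<Rightarrow> bool" where
  "generically P \<longleftrightarrow>
     (\<forall>p. \<exists>r>0. \<exists>k. holomorphic_sv k (ball p r) \<and> (\<exists>z\<in>ball p r. k z \<noteq> 0) \<and>
        (\<forall>z\<in>ball p r. k z \<noteq> 0 \<longrightarrow> P z))"

text \<open>A meromorphic function on the whole space is locally a quotient of holomorphic functions.
  It is represented by a total function, whose values on the thin exceptional sets (poles and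
  points of indeterminacy) are irrelevant; accordingly, equality of meromorphic functions is
  generic equality of representatives.\<close>

definition meromorphic_sv :: "(complex ^ 'm \<Rightarrow> complex) \<Rightarrow> bool" where
  "meromorphic_sv F \<longleftrightarrow>
     (\<forall>p. \<exists>r>0. \<exists>g k. holomorphic_sv g (ball p r) \<and> holomorphic_sv k (ball p r) \<and>
        (\<exists>z\<in>ball p r. k z \<noteq> 0) \<and>
        (\<forall>z\<in>ball p r. k z \<noteq> 0 \<longrightarrow> F z = g z / k z))"

definition meromorphic_eq ::
    "(complex ^ 'm \<Rightarrow> complex) \<Rightarrow> (complex ^ 'm \<Rightarrow> complex) \<Rightarrow> bool" where
  "meromorphic_eq F G \<longleftrightarrow>
     meromorphic_sv F \<and> meromorphic_sv G \<and> generically (\<lambda>z. F z = G z)"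

text \<open>The pair \<open>(u, \<lambda>)\<close> of \<open>\<complex> \<times> \<complex>\<^sup>n\<close> is encoded as one vector indexed by \<open>'n option\<close>: the
  component \<open>None\<close> is \<open>u\<close>, the component \<open>Some i\<close> is \<open>\<lambda>\<^sub>i\<close>.\<close>

definition joint :: "(complex \<Rightarrow> complex ^ 'n \<Rightarrow> 'b) \<Rightarrow> complex ^ ('n option) \<Rightarrow> 'b" where
  "joint F z = F (z $ None) (\<chi> i. z $ Some i)"

section \<open>The matrices\<close>

text \<open>The index set is an arbitrary finite linearly ordered type; \<open>idx\<close> is its order
  isomorphism onto \<open>{1..n}\<close>, where \<open>n = CARD('n)\<close>.\<close>

definition idx :: "'n::{finite,linorder} \<Rightarrow> nat" where
  "idx i = card {..i}"

definition sigma :: "complex ^ 'n \<Rightarrow> complex" where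
  "sigma l = (\<Sum>k\<in>UNIV. l $ k)"

definition K_mat :: "(complex ^ 'n \<Rightarrow> complex) \<Rightarrow> complex \<Rightarrow> complex ^ 'n \<Rightarrow> complex ^ 'n ^ 'n" where
  "K_mat f u l = (\<chi> i j.
     f l * (1 / (f l - (l $ i - l $ j)) - 1 / u) *
       (\<Prod>a\<in>UNIV - {j}. 1 + f l / (l $ j - l $ a)))"

definition b_mat ::
    "complex \<Rightarrow> complex \<Rightarrow> complex \<Rightarrow> complex ^ 'n::{finite,linorder} \<Rightarrow> complex ^ 'n::{finite,linorder} ^ 'n::{finite,linorder}" where
  "b_mat \<gamma> f0 u l = (\<chi> i j.
     if idx i < CARD('n)
     then (l $ j) ^ (idx i - 1) / (\<Prod>a\<in>UNIV - {j}. l $ j - l $ a)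
     else (l $ j) ^ (CARD('n) - 1) * (sigma l - l $ j + u + \<gamma>) /
            ((sigma l + u + f0) * (\<Prod>a\<in>UNIV - {j}. l $ j - l $ a)))"

definition bg_mat ::
    "complex \<Rightarrow> complex \<Rightarrow> complex \<Rightarrow> complex ^ 'n::{finite,linorder} \<Rightarrow> complex ^ 'n::{finite,linorder} ^ 'n::{finite,linorder}" where
  "bg_mat \<gamma> f0 u l = b_mat \<gamma> f0 (u - \<gamma>) l"

definition L_set :: "nat \<Rightarrow> 'n::finite set set" where
  "L_set j = {\<beta>. card \<beta> = CARD('n) - j + 1}"

definition M_coeff ::
    "(complex ^ 'n \<Rightarrow> complex) \<Rightarrow> complex \<Rightarrow> complex ^ 'n \<Rightarrow> nat \<Rightarrow> complex" where
  "M_coeff f u l j = (let n = CARD('n) in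
     of_nat ((n - 1) choose (n - j)) * f l ^ (n - j) * u * (u + sigma l)
     - of_nat (n choose (n - j + 1)) * f l ^ (n - j + 1) * u
     + (- 1) ^ (n - j + 1) * of_nat n * f l * (\<Sum>\<beta>\<in>L_set j. \<Prod>i\<in>\<beta>. l $ i))"

definition Q_mat ::
    "complex \<Rightarrow> complex \<Rightarrow> (complex ^ 'n::{finite,linorder} \<Rightarrow> complex) \<Rightarrow> complex \<Rightarrow> complex ^ 'n::{finite,linorder} \<Rightarrow>
      complex ^ 'n::{finite,linorder} ^ 'n::{finite,linorder}" where
  "Q_mat \<gamma> f0 f u l = (\<chi> i j.
     if i = j then (if idx i < CARD('n) then 1 else 1 - of_nat CARD('n) * f l / u)
     else if j < i then
       (if idx i < CARD('n)
        then of_nat ((idx i - 1) choose (idx i - idx j)) * f l ^ (idx i - idx j)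
        else M_coeff f u l (idx j) / (u * (u + sigma l - \<gamma> + f0)))
     else 0)"

end

theory Submission
  imports Defs "HOL-Complex_Analysis.Conformal_Mappings"
begin

text \<open>Both \<open>b\<^sup>g K\<close> and \<open>Q b\<^sup>g\<close> are computed entrywise. Row \<open>i\<close> of \<open>b\<^sup>g\<close> lists \<open>g\<^sub>i(\<lambda>\<^sub>j) / P'(\<lambda>\<^sub>j)\<close>,
  up to a factor depending only on the row, where \<open>P = \<Prod>\<^sub>a (x - \<lambda>\<^sub>a)\<close>, \<open>g\<^sub>i = x\<^sup>i\<^sup>-\<^sup>1\<close> for \<open>i < n\<close> and
  \<open>g\<^sub>n = x\<^sup>n\<^sup>-\<^sup>1 (\<sigma> + u - x)\<close>. The weights \<open>1 / P'(\<lambda>\<^sub>j)\<close> are those of Lagrange interpolation, and multiplying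
  by \<open>K\<close> replaces \<open>g\<^sub>i(\<lambda>\<^sub>j)\<close> by \<open>g\<^sub>i(\<lambda>\<^sub>j + f)\<close>: the term \<open>- 1 / u\<close> contributes the coefficient of
  \<open>x\<^sup>n\<^sup>-\<^sup>1\<close>, which vanishes for \<open>g\<^sub>i\<close> and equals \<open>u\<close> for \<open>g\<^sub>n + P\<close>. Expanding \<open>g\<^sub>i(\<lambda>\<^sub>j + f)\<close> by the
  binomial theorem, and removing \<open>\<lambda>\<^sub>j\<^sup>n\<close> in the last row by \<open>P(\<lambda>\<^sub>j) = 0\<close>, gives \<open>Q b\<^sup>g\<close>.

  Generic regularity rests on the identity theorem. If \<open>f = \<lambda>\<^sub>i - \<lambda>\<^sub>j\<close> somewhere locally, then
  everywhere, and this contradicts periodicity in \<open>\<lambda>\<^sub>i\<close> when \<open>i \<noteq> j\<close>, and \<open>f \<noteq> 0\<close> when \<open>i = j\<close>.\<close>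

section \<open>Holomorphic functions of several variables\<close>

lemma holomorphic_sv_subset: "holomorphic_sv F S \<Longrightarrow> T \<subseteq> S \<Longrightarrow> holomorphic_sv F T"
  unfolding holomorphic_sv_def by (meson has_derivative_subset subsetD)

lemma holomorphic_sv_const: "holomorphic_sv (\<lambda>z. c) S"
  unfolding holomorphic_sv_def by (auto intro!: exI[of _ 0])

lemma holomorphic_sv_nth: "holomorphic_sv (\<lambda>z. z $ i) S"
  unfolding holomorphic_sv_def
proof (intro ballI exI)
  fix z :: "complex ^ 'a" assume "z \<in> S"
  have "(\<lambda>h::complex^'a. h $ i) = (\<lambda>h. \<Sum>j\<in>UNIV. axis i 1 $ j * h $ j)"
    by (simp add: axis_def if_distrib[of "\<lambda>x. x * _"] cong: if_cong)
  moreover have "((\<lambda>z. z $ i) has_derivative (\<lambda>h. h $ i)) (at z within S)"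
    by (rule bounded_linear_imp_has_derivative) auto
  ultimately show "((\<lambda>z. z $ i) has_derivative (\<lambda>h. \<Sum>j\<in>UNIV. axis i 1 $ j * h $ j)) (at z within S)"
    by metis
qed

lemma holomorphic_sv_add:
  assumes "holomorphic_sv F S" "holomorphic_sv G S"
  shows "holomorphic_sv (\<lambda>z. F z + G z) S"
  unfolding holomorphic_sv_def
proof
  fix z assume z: "z \<in> S"
  obtain c d where c: "(F has_derivative (\<lambda>h. \<Sum>i\<in>UNIV. c $ i * h $ i)) (at z within S)"
    and d: "(G has_derivative (\<lambda>h. \<Sum>i\<in>UNIV. d $ i * h $ i)) (at z within S)"
    using assms z unfolding holomorphic_sv_def by blast
  show "\<exists>e. ((\<lambda>z. F z + G z) has_derivative (\<lambda>h. \<Sum>i\<in>UNIV. e $ i * h $ i)) (at z within S)"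
    using has_derivative_add[OF c d]
    by (intro exI[of _ "c + d"]) (simp add: sum.distrib distrib_right)
qed

lemma holomorphic_sv_mult:
  assumes "holomorphic_sv F S" "holomorphic_sv G S"
  shows "holomorphic_sv (\<lambda>z. F z * G z) S"
  unfolding holomorphic_sv_def
proof
  fix z assume z: "z \<in> S"
  obtain c d where c: "(F has_derivative (\<lambda>h. \<Sum>i\<in>UNIV. c $ i * h $ i)) (at z within S)"
    and d: "(G has_derivative (\<lambda>h. \<Sum>i\<in>UNIV. d $ i * h $ i)) (at z within S)"
    using assms z unfolding holomorphic_sv_def by blast
  show "\<exists>e. ((\<lambda>z. F z * G z) has_derivative (\<lambda>h. \<Sum>i\<in>UNIV. e $ i * h $ i)) (at z within S)"
    using has_derivative_mult[OF c d]
    by (intro exI[of _ "\<chi> i. F z * d $ i + c $ i * G z"])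
      (simp add: sum.distrib distrib_left distrib_right sum_distrib_left sum_distrib_right mult_ac)
qed

lemma holomorphic_sv_minus:
  "holomorphic_sv F S \<Longrightarrow> holomorphic_sv G S \<Longrightarrow> holomorphic_sv (\<lambda>z. F z - G z) S"
  using holomorphic_sv_add[of F S "\<lambda>z. (-1) * G z"]
    holomorphic_sv_mult[OF holomorphic_sv_const[of "-1" S], of G] by simp

lemma holomorphic_sv_sum:
  "(\<And>i. i \<in> I \<Longrightarrow> holomorphic_sv (F i) S) \<Longrightarrow> holomorphic_sv (\<lambda>z. \<Sum>i\<in>I. F i z) S"
  by (induction I rule: infinite_finite_induct)
    (auto intro: holomorphic_sv_const holomorphic_sv_add)

lemma holomorphic_sv_imp_continuous_on: "holomorphic_sv F S \<Longrightarrow> continuous_on S F"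
  unfolding holomorphic_sv_def
  by (meson continuous_on_eq_continuous_within has_derivative_continuous)

text \<open>Restriction to a complex line reduces the identity theorem to one complex
  variable.\<close>

lemma holomorphic_sv_compose_line:
  fixes F :: "complex ^ 'm \<Rightarrow> complex" and v :: "complex ^ 'm"
  assumes F: "holomorphic_sv F S" and S: "open S"
  shows "(\<lambda>t. F (q + t *s v)) holomorphic_on {t. q + t *s v \<in> S}"
  unfolding holomorphic_on_def
proof
  fix t assume t: "t \<in> {t. q + t *s v \<in> S}"
  let ?g = "\<lambda>t. q + t *s v"
  obtain c :: "complex ^ 'm" where "(F has_derivative (\<lambda>h. \<Sum>i\<in>UNIV. c $ i * h $ i)) (at (?g t) within S)"
    using F t unfolding holomorphic_sv_def by blast
  then have c: "(F has_derivative (\<lambda>h. \<Sum>i\<in>UNIV. c $ i * h $ i)) (at (?g t))"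
    using t at_within_open[OF _ S, of "?g t"] by simp
  have "linear (\<lambda>t::complex. t *s v)"
    by (rule linearI) (auto simp: vec_eq_iff algebra_simps)
  then have "bounded_linear (\<lambda>t::complex. t *s v)"
    by (simp add: linear_conv_bounded_linear)
  then have g: "(?g has_derivative (\<lambda>h. h *s v)) (at t)"
    using has_derivative_add[OF has_derivative_const[of q]
      bounded_linear_imp_has_derivative[of "\<lambda>t::complex. t *s v"]] by simp
  have "((\<lambda>t. F (?g t)) has_derivative (\<lambda>h. \<Sum>i\<in>UNIV. c $ i * (h *s v) $ i)) (at t)"
    using has_derivative_compose[OF g c] .
  moreover have "(\<lambda>h. \<Sum>i\<in>UNIV. c $ i * (h *s v) $ i) = (*) (\<Sum>i\<in>UNIV. c $ i * v $ i)"
    by (rule ext) (simp add: sum_distrib_left mult_ac)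
  ultimately have "((\<lambda>t. F (?g t)) has_field_derivative (\<Sum>i\<in>UNIV. c $ i * v $ i)) (at t)"
    by (simp add: has_field_derivative_def)
  then show "(\<lambda>t. F (?g t)) field_differentiable at t within {t. ?g t \<in> S}"
    using field_differentiable_at_within field_differentiable_def by blast
qed

text \<open>On the complex line through \<open>q\<close> and \<open>w\<close>, the parameters mapped
  into \<open>S\<close> form a convex, hence connected set. \<open>F\<close> vanishes there near t =
  0, so by the one-variable identity theorem also at t = 1, the parameter of
  \<open>w\<close>.\<close>

lemma holomorphic_sv_identity:
  fixes F :: "complex ^ 'm \<Rightarrow> complex"
  assumes F: "holomorphic_sv F S" and S: "open S" "convex S"
    and U: "open U" "q \<in> U" "U \<subseteq> S" "\<And>z. z \<in> U \<Longrightarrow> F z = 0" and w: "w \<in> S"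
  shows "F w = 0"
proof -
  let ?g = "\<lambda>t::complex. q + t *s (w - q)"
  have lin: "linear (\<lambda>t::complex. t *s (w - q))"
    by (rule linearI) (auto simp: vec_eq_iff algebra_simps)
  have cont: "continuous_on UNIV ?g"
    by (intro continuous_intros linear_continuous_on linear_conv_bounded_linear[THEN iffD1] lin)
  have op: "open {t. ?g t \<in> V}" if "open V" for V
    using open_vimage[OF that cont] by (simp add: vimage_def)
  have "{t. ?g t \<in> S} = (\<lambda>t. t *s (w - q)) -` ((\<lambda>x. - q + x) ` S)"
    by (auto simp: image_iff algebra_simps intro!: bexI[rotated])
  then have conv: "convex {t. ?g t \<in> S}"
    using convex_linear_vimage[OF lin convex_translation[OF S(2)]] by metis
  have "F (?g 1) = 0"
  proof (rule analytic_continuation_open[where s = "{t. ?g t \<in> U}" and g = "\<lambda>_. 0"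
        and f = "\<lambda>t. F (?g t)" and s' = "{t. ?g t \<in> S}"])
    show "{t. ?g t \<in> U} \<noteq> {}" using U(2) by (auto intro!: exI[of _ 0])
    show "connected {t. ?g t \<in> S}" using conv by (rule convex_connected)
    show "(\<lambda>t. F (?g t)) holomorphic_on {t. ?g t \<in> S}"
      by (rule holomorphic_sv_compose_line[OF F S(1)])
  qed (use op U S w in auto)
  then show ?thesis by simp
qed

text \<open>There are no zero divisors: if the product vanished, \<open>G\<close> would vanish on
  the nonempty open set where \<open>F\<close> does not, hence on all of \<open>S\<close>.\<close>

lemma holomorphic_sv_nonzero_mult:
  fixes F G :: "complex ^ 'm \<Rightarrow> complex"
  assumes F: "holomorphic_sv F S" and G: "holomorphic_sv G S" and S: "open S" "convex S"
    and "\<exists>z\<in>S. F z \<noteq> 0" "\<exists>z\<in>S. G z \<noteq> 0"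
  shows "\<exists>z\<in>S. F z * G z \<noteq> 0"
proof (rule ccontr)
  assume *: "\<not> ?thesis"
  let ?U = "S \<inter> F -` (- {0})"
  have "open ?U"
    by (rule continuous_open_preimage[OF holomorphic_sv_imp_continuous_on[OF F] S(1)]) auto
  moreover obtain q where "q \<in> ?U" using assms by auto
  moreover have "G z = 0" if "z \<in> ?U" for z using * that by auto
  ultimately show False
    using holomorphic_sv_identity[OF G S, of ?U q] assms by blast
qed

text \<open>This allows radii to be shrunk: by the identity theorem a nonzero denominator stays
  nonzero on smaller balls.\<close>

lemma holomorphic_sv_nonzero_subball:
  fixes F :: "complex ^ 'm \<Rightarrow> complex"
  assumes F: "holomorphic_sv F S" and S: "open S" "convex S" and "\<exists>z\<in>S. F z \<noteq> 0"
    and U: "open U" "U \<noteq> {}" "U \<subseteq> S"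
  shows "\<exists>z\<in>U. F z \<noteq> 0"
  using holomorphic_sv_identity[OF F S] assms by (metis ex_in_conv)

text \<open>Coordinate inclusions followed by a translation cover both the shift of \<open>\<lambda>\<close> and the
  projection forgetting \<open>u\<close>.\<close>

definition reindex :: "('k \<Rightarrow> 'm) \<Rightarrow> complex ^ 'k \<Rightarrow> complex ^ 'm \<Rightarrow> complex ^ 'k" where
  "reindex s v z = (\<chi> i. z $ s i + v $ i)"

lemma holomorphic_sv_reindex:
  fixes s :: "'k::finite \<Rightarrow> 'm::finite"
  assumes F: "holomorphic_sv F S" and T: "open T" "\<And>z. z \<in> T \<Longrightarrow> reindex s v z \<in> S" "open S"
  shows "holomorphic_sv (\<lambda>z. F (reindex s v z)) T"
  unfolding holomorphic_sv_def
proof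
  fix z assume z: "z \<in> T"
  obtain c where "(F has_derivative (\<lambda>h. \<Sum>i\<in>UNIV. c $ i * h $ i)) (at (reindex s v z) within S)"
    using F T z unfolding holomorphic_sv_def by blast
  then have c: "(F has_derivative (\<lambda>h. \<Sum>i\<in>UNIV. c $ i * h $ i)) (at (reindex s v z))"
    using T(2)[OF z] at_within_open[OF _ T(3), of "reindex s v z"] by simp
  let ?L = "\<lambda>h::complex^'m. (\<chi> i. h $ s i) :: complex^'k"
  have "linear ?L" by (rule linearI) (auto simp: vec_eq_iff)
  then have "(?L has_derivative ?L) (at z within T)"
    by (simp add: linear_conv_bounded_linear bounded_linear_imp_has_derivative)
  from has_derivative_add[OF this has_derivative_const[of v]]
  have g: "(reindex s v has_derivative ?L) (at z within T)"
    by (simp add: reindex_def[abs_def] plus_vec_def)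
  have "((\<lambda>z. F (reindex s v z)) has_derivative (\<lambda>h. \<Sum>i\<in>UNIV. c $ i * ?L h $ i)) (at z within T)"
    by (rule has_derivative_compose[OF g c])
  \<comment> \<open>The coefficient of \<open>h $ j\<close> collects \<open>c $ i\<close> over the
    fibre of \<open>s\<close> above \<open>j\<close>.\<close>
  moreover let ?d = "\<chi> j. \<Sum>i | s i = j. c $ i"
  have "(\<Sum>i\<in>UNIV. c $ i * ?L h $ i) =
      (\<Sum>j\<in>UNIV. ?d $ j * h $ j)" for h
  proof -
    have "(\<Sum>i\<in>UNIV. c $ i * h $ s i) = (\<Sum>j\<in>UNIV. \<Sum>i | i \<in> UNIV \<and> s i = j. c $ i * h $ s i)"
      by (rule sum.group[symmetric]) auto
    then show ?thesis by (auto simp: sum_distrib_right intro!: sum.cong)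
  qed
  ultimately show "\<exists>e. ((\<lambda>z. F (reindex s v z)) has_derivative (\<lambda>h. \<Sum>i\<in>UNIV. e $ i * h $ i)) (at z within T)"
    by (intro exI[of _ ?d]) (simp only:)
qed

text \<open>The translation cancels, and injectivity of \<open>s\<close> makes the left squared
  distance a subsum of the right one.\<close>

lemma dist_reindex_le:
  fixes s :: "'k::finite \<Rightarrow> 'm::finite"
  assumes "inj s"
  shows "dist (reindex s v z) (reindex s v p) \<le> dist z p"
proof -
  have "(\<Sum>i\<in>UNIV. (dist (z $ s i) (p $ s i))\<^sup>2) = (\<Sum>j\<in>range s. (dist (z $ j) (p $ j))\<^sup>2)"
    using assms by (simp add: sum.reindex)
  also have "\<dots> \<le> (\<Sum>j\<in>UNIV. (dist (z $ j) (p $ j))\<^sup>2)"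
    by (rule sum_mono2) auto
  finally show ?thesis
    by (simp add: reindex_def dist_vec_def L2_set_def dist_norm)
qed

text \<open>Serves to pull back points where a denominator is nonzero. The lift keeps the
  coordinates of \<open>p\<close> outside the range of \<open>s\<close>, so they add nothing to the
  distance.\<close>

lemma reindex_ball_surj:
  fixes s :: "'k::finite \<Rightarrow> 'm::finite"
  assumes s: "inj s" and y: "y \<in> ball (reindex s v p) r"
  obtains z where "z \<in> ball p r" "reindex s v z = y"
proof
  define z where "z = (\<chi> j. if j \<in> range s then y $ inv s j - v $ inv s j else p $ j)"
  show eq: "reindex s v z = y"
    using s by (auto simp: reindex_def z_def vec_eq_iff)
  have "(\<Sum>i\<in>UNIV. (dist (z $ s i) (p $ s i))\<^sup>2) = (\<Sum>j\<in>range s. (dist (z $ j) (p $ j))\<^sup>2)"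
    using s by (simp add: sum.reindex)
  also have "\<dots> = (\<Sum>j\<in>UNIV. (dist (z $ j) (p $ j))\<^sup>2)"
    by (rule sum.mono_neutral_left) (auto simp: z_def)
  finally have "dist (reindex s v z) (reindex s v p) = dist z p"
    by (simp add: reindex_def dist_vec_def L2_set_def dist_norm)
  then show "z \<in> ball p r" using y eq by (simp add: dist_commute)
qed

section \<open>Generic properties\<close>

lemma generically_mono: "generically P \<Longrightarrow> (\<And>z. P z \<Longrightarrow> Q z) \<Longrightarrow> generically Q"
  unfolding generically_def by meson

lemma generically_ex: "generically P \<Longrightarrow> \<exists>z. P z"
  unfolding generically_def by blast

lemma generically_nonzero:
  assumes "holomorphic_sv k UNIV" "k z0 \<noteq> 0"
  shows "generically (\<lambda>z. k z \<noteq> 0)"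
  unfolding generically_def
proof
  fix p
  show "\<exists>r>0. \<exists>k'. holomorphic_sv k' (ball p r) \<and> (\<exists>z\<in>ball p r. k' z \<noteq> 0) \<and>
      (\<forall>z\<in>ball p r. k' z \<noteq> 0 \<longrightarrow> k z \<noteq> 0)"
    using assms
    by (intro exI[of _ "dist p z0 + 1"] conjI exI[of _ k])
      (auto intro!: bexI[of _ z0] holomorphic_sv_subset[of k UNIV] add_nonneg_pos)
qed

text \<open>Common refinement of two local descriptions at one base point: on the smaller ball the
  product of both denominators is still not identically zero.\<close>

lemma nonzero_on_common_ball:
  fixes k1 k2 :: "complex ^ 'm \<Rightarrow> complex"
  assumes "holomorphic_sv k1 (ball p r1)" "\<exists>z\<in>ball p r1. k1 z \<noteq> 0" "r1 > 0"
    and "holomorphic_sv k2 (ball p r2)" "\<exists>z\<in>ball p r2. k2 z \<noteq> 0" "r2 > 0"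
  obtains r where "r > 0" "ball p r \<subseteq> ball p r1" "ball p r \<subseteq> ball p r2"
    "holomorphic_sv k1 (ball p r)" "holomorphic_sv k2 (ball p r)" "\<exists>z\<in>ball p r. k1 z * k2 z \<noteq> 0"
proof -
  define r where "r = min r1 r2"
  have r: "r > 0" "ball p r \<subseteq> ball p r1" "ball p r \<subseteq> ball p r2" using assms by (auto simp: r_def)
  have h: "holomorphic_sv k1 (ball p r)" "holomorphic_sv k2 (ball p r)"
    using assms r holomorphic_sv_subset by blast+
  have "\<exists>z\<in>ball p r. k1 z \<noteq> 0" 
    by (rule holomorphic_sv_nonzero_subball[OF assms(1) _ _ assms(2)]) (use r in auto)
  moreover have "\<exists>z\<in>ball p r. k2 z \<noteq> 0"
    by (rule holomorphic_sv_nonzero_subball[OF assms(4) _ _ assms(5)]) (use r in auto)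
  ultimately have "\<exists>z\<in>ball p r. k1 z * k2 z \<noteq> 0"
    using holomorphic_sv_nonzero_mult[OF h] by auto
  with that r h show ?thesis by blast
qed

lemma generically_conj:
  assumes "generically P" "generically Q"
  shows "generically (\<lambda>z. P z \<and> Q z)"
  unfolding generically_def
proof
  fix p
  obtain r1 k1 where 1: "r1 > 0" "holomorphic_sv k1 (ball p r1)" "\<exists>z\<in>ball p r1. k1 z \<noteq> 0"
      "\<forall>z\<in>ball p r1. k1 z \<noteq> 0 \<longrightarrow> P z"
    using assms(1) unfolding generically_def by blast
  obtain r2 k2 where 2: "r2 > 0" "holomorphic_sv k2 (ball p r2)" "\<exists>z\<in>ball p r2. k2 z \<noteq> 0"
      "\<forall>z\<in>ball p r2. k2 z \<noteq> 0 \<longrightarrow> Q z"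
    using assms(2) unfolding generically_def by blast
  obtain r where r: "r > 0" "ball p r \<subseteq> ball p r1" "ball p r \<subseteq> ball p r2"
    "holomorphic_sv k1 (ball p r)" "holomorphic_sv k2 (ball p r)" "\<exists>z\<in>ball p r. k1 z * k2 z \<noteq> 0"
    by (rule nonzero_on_common_ball[OF 1(2,3,1) 2(2,3,1)])
  show "\<exists>r>0. \<exists>k. holomorphic_sv k (ball p r) \<and> (\<exists>z\<in>ball p r. k z \<noteq> 0) \<and>
      (\<forall>z\<in>ball p r. k z \<noteq> 0 \<longrightarrow> P z \<and> Q z)"
    using r 1 2 holomorphic_sv_mult[OF r(4,5)]
    by (intro exI[of _ r] conjI exI[of _ "\<lambda>z. k1 z * k2 z"]) auto
qed

lemma generically_True: "generically (\<lambda>z. True)"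
  by (rule generically_mono[OF generically_nonzero[of "\<lambda>_. 1" 0]]) (auto intro: holomorphic_sv_const)

lemma generically_Ball:
  assumes "finite I" "\<And>i. i \<in> I \<Longrightarrow> generically (P i)"
  shows "generically (\<lambda>z. \<forall>i\<in>I. P i z)"
  using assms by (induction I rule: finite_induct) (auto simp: generically_True intro: generically_conj)

lemma generically_all:
  fixes P :: "'i::finite \<Rightarrow> _"
  shows "(\<And>i. generically (P i)) \<Longrightarrow> generically (\<lambda>z. \<forall>i. P i z)"
  using generically_Ball[of UNIV P] by simp

text \<open>The function \<open>k\<close> is pulled back; it stays nonzero somewhere because the
  ball around \<open>p\<close> maps onto the ball around the image of \<open>p\<close>.\<close>

lemma generically_reindex:
  fixes s :: "'k::finite \<Rightarrow> 'm::finite"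
  assumes s: "inj s" and P: "generically P"
  shows "generically (\<lambda>z. P (reindex s v z))"
  unfolding generically_def
proof
  fix p
  let ?T = "reindex s v"
  obtain r k where k: "r > 0" "holomorphic_sv k (ball (?T p) r)" "\<exists>z\<in>ball (?T p) r. k z \<noteq> 0"
      "\<forall>z\<in>ball (?T p) r. k z \<noteq> 0 \<longrightarrow> P z"
    using P unfolding generically_def by blast
  have T: "?T z \<in> ball (?T p) r" if "z \<in> ball p r" for z
    using dist_reindex_le[OF s, of v p z] that by simp
  have "\<exists>z\<in>ball p r. k (?T z) \<noteq> 0"
    using k(3) reindex_ball_surj[OF s] by metis
  moreover have "holomorphic_sv (\<lambda>z. k (?T z)) (ball p r)"
    using k T by (intro holomorphic_sv_reindex[OF k(2)]) auto
  ultimately show "\<exists>r>0. \<exists>k. holomorphic_sv k (ball p r) \<and> (\<exists>z\<in>ball p r. k z \<noteq> 0) \<and>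
      (\<forall>z\<in>ball p r. k z \<noteq> 0 \<longrightarrow> P (?T z))"
    using k T by (intro exI[of _ r] conjI exI[of _ "\<lambda>z. k (?T z)"]) auto
qed

section \<open>Meromorphic functions\<close>

text \<open>Exposes the local data of \<open>meromorphic_sv\<close> at one base point.\<close>

definition quotient_on ::
    "(complex ^ 'm \<Rightarrow> complex) \<Rightarrow> complex ^ 'm \<Rightarrow> real \<Rightarrow> (complex ^ 'm \<Rightarrow> complex) \<Rightarrow> (complex ^ 'm \<Rightarrow> complex) \<Rightarrow> bool" where
  "quotient_on F p r g k \<longleftrightarrow> r > 0 \<and> holomorphic_sv g (ball p r) \<and> holomorphic_sv k (ball p r) \<and>
    (\<exists>z\<in>ball p r. k z \<noteq> 0) \<and> (\<forall>z\<in>ball p r. k z \<noteq> 0 \<longrightarrow> F z = g z / k z)"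

lemma meromorphic_svE:
  assumes "meromorphic_sv F"
  obtains r g k where "r > 0" "holomorphic_sv g (ball p r)" "holomorphic_sv k (ball p r)"
    "\<exists>z\<in>ball p r. k z \<noteq> 0" "\<And>z. z \<in> ball p r \<Longrightarrow> k z \<noteq> 0 \<Longrightarrow> F z = g z / k z"
  using assms unfolding meromorphic_sv_def by metis

lemma meromorphic_svI: "(\<And>p. \<exists>r g k. quotient_on F p r g k) \<Longrightarrow> meromorphic_sv F"
  unfolding meromorphic_sv_def quotient_on_def by metis

lemma holomorphic_imp_meromorphic_sv:
  assumes "holomorphic_sv F UNIV"
  shows "meromorphic_sv F"
proof (rule meromorphic_svI)
  fix p
  have "quotient_on F p 1 F (\<lambda>_. 1)"
    using assms by (auto simp: quotient_on_def intro: holomorphic_sv_const holomorphic_sv_subset exI[of _ p])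
  then show "\<exists>r g k. quotient_on F p r g k" by blast
qed

text \<open>Multiplying numerator and denominator by \<open>k2\<close> moves the points where the
  functions may differ into the zero set of the denominator. This yields meromorphy of a matrix
  inverse expression without writing it out.\<close>

lemma meromorphic_sv_generically_eq:
  assumes F: "meromorphic_sv F" and eq: "generically (\<lambda>z. F z = G z)"
  shows "meromorphic_sv G"
proof (rule meromorphic_svI)
  fix p
  obtain r1 g k1 where 1: "r1 > 0" "holomorphic_sv g (ball p r1)" "holomorphic_sv k1 (ball p r1)"
    "\<exists>z\<in>ball p r1. k1 z \<noteq> 0" "\<And>z. z \<in> ball p r1 \<Longrightarrow> k1 z \<noteq> 0 \<Longrightarrow> F z = g z / k1 z"
    using meromorphic_svE[OF F, of p] by blast
  obtain r2 k2 where 2: "r2 > 0" "holomorphic_sv k2 (ball p r2)" "\<exists>z\<in>ball p r2. k2 z \<noteq> 0"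
      "\<forall>z\<in>ball p r2. k2 z \<noteq> 0 \<longrightarrow> F z = G z"
    using eq unfolding generically_def by blast
  obtain r where r: "r > 0" "ball p r \<subseteq> ball p r1" "ball p r \<subseteq> ball p r2"
    "holomorphic_sv k1 (ball p r)" "holomorphic_sv k2 (ball p r)" "\<exists>z\<in>ball p r. k1 z * k2 z \<noteq> 0"
    by (rule nonzero_on_common_ball[OF 1(3,4,1) 2(2,3,1)])
  have g: "holomorphic_sv g (ball p r)" using 1 r holomorphic_sv_subset by blast
  have "G z = (g z * k2 z) / (k1 z * k2 z)" if "z \<in> ball p r" "k1 z * k2 z \<noteq> 0" for z
  proof -
    have "z \<in> ball p r1" "z \<in> ball p r2" "k1 z \<noteq> 0" "k2 z \<noteq> 0" using that r(2,3) by auto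
    then show ?thesis using 1(5)[of z] 2(4) by simp
  qed
  then have "quotient_on G p r (\<lambda>z. g z * k2 z) (\<lambda>z. k1 z * k2 z)"
    using r holomorphic_sv_mult[OF g r(5)] holomorphic_sv_mult[OF r(4,5)]
    unfolding quotient_on_def by blast
  then show "\<exists>r g k. quotient_on G p r g k" by blast
qed

lemma meromorphic_sv_add_mult:
  assumes F: "meromorphic_sv F" and G: "meromorphic_sv G"
  shows meromorphic_sv_add: "meromorphic_sv (\<lambda>z. F z + G z)"
    and meromorphic_sv_mult: "meromorphic_sv (\<lambda>z. F z * G z)"
proof -
  have *: "\<exists>r g h k. quotient_on (\<lambda>z. F z + G z) p r g k \<and> quotient_on (\<lambda>z. F z * G z) p r h k" for p
  proof -
    obtain r1 g1 k1 where 1: "r1 > 0" "holomorphic_sv g1 (ball p r1)" "holomorphic_sv k1 (ball p r1)"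
      "\<exists>z\<in>ball p r1. k1 z \<noteq> 0" "\<And>z. z \<in> ball p r1 \<Longrightarrow> k1 z \<noteq> 0 \<Longrightarrow> F z = g1 z / k1 z"
      using meromorphic_svE[OF F, of p] by blast
    obtain r2 g2 k2 where 2: "r2 > 0" "holomorphic_sv g2 (ball p r2)" "holomorphic_sv k2 (ball p r2)"
      "\<exists>z\<in>ball p r2. k2 z \<noteq> 0" "\<And>z. z \<in> ball p r2 \<Longrightarrow> k2 z \<noteq> 0 \<Longrightarrow> G z = g2 z / k2 z"
      using meromorphic_svE[OF G, of p] by blast
    obtain r where r: "r > 0" "ball p r \<subseteq> ball p r1" "ball p r \<subseteq> ball p r2"
      "holomorphic_sv k1 (ball p r)" "holomorphic_sv k2 (ball p r)" "\<exists>z\<in>ball p r. k1 z * k2 z \<noteq> 0"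
      by (rule nonzero_on_common_ball[OF 1(3,4,1) 2(3,4,1)])
    have g: "holomorphic_sv g1 (ball p r)" "holomorphic_sv g2 (ball p r)"
      using 1 2 r holomorphic_sv_subset by blast+
    have "F z + G z = (g1 z * k2 z + g2 z * k1 z) / (k1 z * k2 z) \<and>
        F z * G z = (g1 z * g2 z) / (k1 z * k2 z)" if "z \<in> ball p r" "k1 z * k2 z \<noteq> 0" for z
    proof -
      have "z \<in> ball p r1" "z \<in> ball p r2" "k1 z \<noteq> 0" "k2 z \<noteq> 0" using that r(2,3) by auto
      then show ?thesis using 1(5)[of z] 2(5)[of z] by (simp add: add_frac_eq)
    qed
    then have "quotient_on (\<lambda>z. F z + G z) p r (\<lambda>z. g1 z * k2 z + g2 z * k1 z) (\<lambda>z. k1 z * k2 z)"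
        "quotient_on (\<lambda>z. F z * G z) p r (\<lambda>z. g1 z * g2 z) (\<lambda>z. k1 z * k2 z)"
      using r g by (auto simp: quotient_on_def intro: holomorphic_sv_add holomorphic_sv_mult)
    then show ?thesis by blast
  qed
  have "\<exists>r g k. quotient_on (\<lambda>z. F z + G z) p r g k" "\<exists>r h k. quotient_on (\<lambda>z. F z * G z) p r h k" for p
    using *[of p] by blast+
  then show "meromorphic_sv (\<lambda>z. F z + G z)" "meromorphic_sv (\<lambda>z. F z * G z)"
    by (simp_all add: meromorphic_svI)
qed

text \<open>No hypothesis \<open>F \<noteq> 0\<close>: where \<open>F\<close> vanishes identically, so does the total function
  \<open>inverse \<circ> F\<close>.\<close>

lemma meromorphic_sv_inverse:
  assumes F: "meromorphic_sv F"
  shows "meromorphic_sv (\<lambda>z. inverse (F z))"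
proof (rule meromorphic_svI)
  fix p
  obtain r g k where 1: "r > 0" "holomorphic_sv g (ball p r)" "holomorphic_sv k (ball p r)"
    "\<exists>z\<in>ball p r. k z \<noteq> 0" "\<And>z. z \<in> ball p r \<Longrightarrow> k z \<noteq> 0 \<Longrightarrow> F z = g z / k z"
    using meromorphic_svE[OF F, of p] by blast
  show "\<exists>r g k. quotient_on (\<lambda>z. inverse (F z)) p r g k"
  proof (cases "\<exists>z\<in>ball p r. g z \<noteq> 0")
    case True
    have "\<exists>z\<in>ball p r. g z * k z \<noteq> 0"
      using holomorphic_sv_nonzero_mult[OF 1(2,3)] True 1 by auto
    \<comment> \<open>The fraction \<open>k / g\<close> is expanded by \<open>k\<close> because the
      quotient for \<open>F\<close> is known only where \<open>k\<close> is nonzero.\<close>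
    then have "quotient_on (\<lambda>z. inverse (F z)) p r (\<lambda>z. k z * k z) (\<lambda>z. g z * k z)"
      using 1 by (auto simp: quotient_on_def intro: holomorphic_sv_mult)
    then show ?thesis by blast
  next
    case False
    then have "quotient_on (\<lambda>z. inverse (F z)) p r (\<lambda>z. 0) k"
      using 1 by (auto simp: quotient_on_def intro: holomorphic_sv_const)
    then show ?thesis by blast
  qed
qed

lemma meromorphic_sv_const: "meromorphic_sv (\<lambda>z. c)"
  by (intro holomorphic_imp_meromorphic_sv holomorphic_sv_const)

lemma meromorphic_sv_nth: "meromorphic_sv (\<lambda>z. z $ i)"
  by (intro holomorphic_imp_meromorphic_sv holomorphic_sv_nth)

lemma meromorphic_sv_diff:
  assumes "meromorphic_sv F" "meromorphic_sv G"
  shows "meromorphic_sv (\<lambda>z. F z - G z)"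
  using meromorphic_sv_add[OF assms(1) meromorphic_sv_mult[OF meromorphic_sv_const[of "-1"] assms(2)]]
  by simp

lemma meromorphic_sv_divide:
  assumes "meromorphic_sv F" "meromorphic_sv G"
  shows "meromorphic_sv (\<lambda>z. F z / G z)"
  using meromorphic_sv_mult[OF assms(1) meromorphic_sv_inverse[OF assms(2)]]
  by (simp add: divide_inverse)

lemma meromorphic_sv_prod:
  "(\<And>i. i \<in> I \<Longrightarrow> meromorphic_sv (F i)) \<Longrightarrow> meromorphic_sv (\<lambda>z. \<Prod>i\<in>I. F i z)"
  by (induction I rule: infinite_finite_induct)
    (auto intro: meromorphic_sv_const meromorphic_sv_mult)

lemma meromorphic_sv_reindex:
  fixes s :: "'k::finite \<Rightarrow> 'm::finite"
  assumes s: "inj s" and F: "meromorphic_sv F"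
  shows "meromorphic_sv (\<lambda>z. F (reindex s v z))"
proof (rule meromorphic_svI)
  fix p
  let ?T = "reindex s v"
  obtain r g k where k: "r > 0" "holomorphic_sv g (ball (?T p) r)" "holomorphic_sv k (ball (?T p) r)"
    "\<exists>z\<in>ball (?T p) r. k z \<noteq> 0" "\<And>z. z \<in> ball (?T p) r \<Longrightarrow> k z \<noteq> 0 \<Longrightarrow> F z = g z / k z"
    using meromorphic_svE[OF F, of "?T p"] by blast
  have T: "?T z \<in> ball (?T p) r" if "z \<in> ball p r" for z
    using dist_reindex_le[OF s, of v p z] that by simp
  have "\<exists>z\<in>ball p r. k (?T z) \<noteq> 0"
    using k(4) reindex_ball_surj[OF s] by metis
  moreover have "holomorphic_sv (\<lambda>z. k (?T z)) (ball p r)" "holomorphic_sv (\<lambda>z. g (?T z)) (ball p r)"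
    using k T by (auto intro!: holomorphic_sv_reindex[OF k(2)] holomorphic_sv_reindex[OF k(3)])
  ultimately have "quotient_on (\<lambda>z. F (?T z)) p r (\<lambda>z. g (?T z)) (\<lambda>z. k (?T z))"
    using k T by (simp add: quotient_on_def)
  then show "\<exists>r g k. quotient_on (\<lambda>z. F (?T z)) p r g k" by blast
qed

text \<open>Both alternatives hold on an open set of base points, and they exclude each other, so
  connectedness of the whole space decides between them.\<close>

lemma meromorphic_sv_zero_or_nonzero:
  fixes F :: "complex ^ 'm \<Rightarrow> complex"
  assumes F: "meromorphic_sv F"
  shows "generically (\<lambda>z. F z = 0) \<or> generically (\<lambda>z. F z \<noteq> 0)"
proof -
  \<comment> \<open>\<open>loc P p\<close> is the condition in \<open>generically\<close> at a
    single base point.\<close>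
  define loc where "loc P p \<longleftrightarrow> (\<exists>r>0. \<exists>k. holomorphic_sv k (ball p r) \<and> (\<exists>z\<in>ball p r. k z \<noteq> 0) \<and>
      (\<forall>z\<in>ball p r. k z \<noteq> 0 \<longrightarrow> P z))" for P and p :: "complex ^ 'm"
  have open_loc: "open {p. loc P p}" for P
    unfolding open_contains_ball
  proof
    fix p assume "p \<in> {p. loc P p}"
    then obtain r k where k: "r > 0" "holomorphic_sv k (ball p r)" "\<exists>z\<in>ball p r. k z \<noteq> 0"
        "\<forall>z\<in>ball p r. k z \<noteq> 0 \<longrightarrow> P z"
      unfolding loc_def by blast
    have "loc P q" if q: "q \<in> ball p r" for q
    proof -
      obtain e where e: "e > 0" "ball q e \<subseteq> ball p r" using q by (meson open_ball open_contains_ball)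
      have "\<exists>z\<in>ball q e. k z \<noteq> 0"
        by (rule holomorphic_sv_nonzero_subball[OF k(2) _ _ k(3)]) (use e in auto)
      then show ?thesis unfolding loc_def using e k holomorphic_sv_subset[OF k(2) e(2)]
        by (intro exI[of _ e] conjI exI[of _ k]) auto
    qed
    then show "\<exists>e>0. ball p e \<subseteq> {p. loc P p}" using k(1) by blast
  qed
  have excl: "\<not> (loc (\<lambda>z. F z = 0) p \<and> loc (\<lambda>z. F z \<noteq> 0) p)" for p
  proof
    assume "loc (\<lambda>z. F z = 0) p \<and> loc (\<lambda>z. F z \<noteq> 0) p"
    then obtain r1 k1 r2 k2 where
      1: "r1 > 0" "holomorphic_sv k1 (ball p r1)" "\<exists>z\<in>ball p r1. k1 z \<noteq> 0"
        "\<forall>z\<in>ball p r1. k1 z \<noteq> 0 \<longrightarrow> F z = 0" and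
      2: "r2 > 0" "holomorphic_sv k2 (ball p r2)" "\<exists>z\<in>ball p r2. k2 z \<noteq> 0"
        "\<forall>z\<in>ball p r2. k2 z \<noteq> 0 \<longrightarrow> F z \<noteq> 0"
      unfolding loc_def by blast
    then show False
      using nonzero_on_common_ball[OF 1(2,3,1) 2(2,3,1)]
      by (metis mult_zero_left mult_zero_right subsetD)
  qed
  \<comment> \<open>With \<open>F = g / k\<close> near \<open>p\<close>, the choice depends on
    whether \<open>g\<close> vanishes identically on the ball.\<close>
  have cover: "loc (\<lambda>z. F z = 0) p \<or> loc (\<lambda>z. F z \<noteq> 0) p" for p
  proof -
    obtain r g k where 1: "r > 0" "holomorphic_sv g (ball p r)" "holomorphic_sv k (ball p r)"
      "\<exists>z\<in>ball p r. k z \<noteq> 0" "\<And>z. z \<in> ball p r \<Longrightarrow> k z \<noteq> 0 \<Longrightarrow> F z = g z / k z"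
      using meromorphic_svE[OF F, of p] by blast
    show ?thesis
    proof (cases "\<exists>z\<in>ball p r. g z \<noteq> 0")
      case True
      have "\<exists>z\<in>ball p r. g z * k z \<noteq> 0"
        using holomorphic_sv_nonzero_mult[OF 1(2,3)] True 1 by auto
      then have "loc (\<lambda>z. F z \<noteq> 0) p"
        unfolding loc_def using 1 holomorphic_sv_mult[OF 1(2,3)]
        by (intro exI[of _ r] conjI exI[of _ "\<lambda>z. g z * k z"]) auto
      then show ?thesis ..
    next
      case False
      then have "loc (\<lambda>z. F z = 0) p"
        unfolding loc_def using 1 by (intro exI[of _ r] conjI exI[of _ k]) auto
      then show ?thesis ..
    qed
  qed
  have "{p. loc (\<lambda>z. F z = 0) p} = {} \<or> {p. loc (\<lambda>z. F z \<noteq> 0) p} = {}"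
    using connectedD[OF connected_UNIV open_loc open_loc, of "\<lambda>z. F z = 0" "\<lambda>z. F z \<noteq> 0"] excl cover by auto
  then show ?thesis
    using cover unfolding generically_def loc_def[symmetric] by blast
qed

section \<open>Interpolation at the points \<open>\<lambda>\<^sub>1, \<dots>, \<lambda>\<^sub>n\<close>\<close>

text \<open>The elementary symmetric polynomial of degree \<open>m\<close>; for
  \<open>m = n - j + 1\<close> it is the sum over \<open>L_set j\<close> in
  \<open>M_coeff\<close>.\<close>

definition esym :: "nat \<Rightarrow> complex ^ 'n::finite \<Rightarrow> complex" where
  "esym m l = (\<Sum>\<beta> | card \<beta> = m. \<Prod>i\<in>\<beta>. l $ i)"

lemma esym_0: "esym 0 l = 1"
  by (simp add: esym_def)

lemma esym_1:
  fixes l :: "complex ^ 'n::finite"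
  shows "esym (Suc 0) l = sigma l"
proof -
  have "{\<beta> :: 'n::finite set. card \<beta> = Suc 0} = (\<lambda>i. {i}) ` UNIV"
    by (auto simp: card_Suc_eq)
  then have "esym (Suc 0) l = (\<Sum>\<beta>\<in>range (\<lambda>i. {i}). \<Prod>i\<in>\<beta>. l $ i)"
    by (simp only: esym_def)
  also have "\<dots> = sigma l"
    by (subst sum.reindex) (auto simp: sigma_def inj_def)
  finally show ?thesis .
qed

text \<open>Vieta's formulas: the product is expanded over the set \<open>X\<close> of factors
  contributing \<open>- (l $ a)\<close>, and terms are grouped by the power of
  \<open>x\<close>.\<close>

lemma prod_diff_expand:
  fixes l :: "complex ^ 'n::finite"
  shows "(\<Prod>a\<in>UNIV. x - l $ a) = (\<Sum>k\<le>CARD('n). (-1) ^ (CARD('n) - k) * esym (CARD('n) - k) l * x ^ k)"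
proof -
  let ?n = "CARD('n)"
  have "(\<Prod>a\<in>UNIV. x - l $ a) = (\<Prod>a\<in>UNIV. - (l $ a) + x)"
    by simp
  also have "\<dots> = (\<Sum>X\<in>Pow UNIV. (\<Prod>a\<in>X. - (l $ a)) * (\<Prod>a\<in>UNIV - X. x))"
    by (rule prod_add) simp
  also have "\<dots> = (\<Sum>X\<in>UNIV. (-1) ^ card X * (\<Prod>a\<in>X. l $ a) * x ^ (?n - card X))"
    by (simp add: prod_uminus card_Diff_subset)
  also have "\<dots> = (\<Sum>k\<in>{..?n}. \<Sum>X | X \<in> UNIV \<and> ?n - card X = k.
      (-1) ^ card X * (\<Prod>a\<in>X. l $ a) * x ^ (?n - card X))"
    by (rule sum.group[symmetric]) auto
  also have "\<dots> = (\<Sum>k\<le>?n. (-1) ^ (?n - k) * esym (?n - k) l * x ^ k)"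
  proof (rule sum.cong[OF refl])
    fix k assume k: "k \<in> {..?n}"
    \<comment> \<open>Subtraction on naturals truncates; this bound makes \<open>k\<close> determine
      \<open>card X\<close>.\<close>
    have le: "card X \<le> ?n" for X :: "'n set" by (simp add: card_mono)
    have "{X::'n set. X \<in> UNIV \<and> ?n - card X = k} = {X. card X = ?n - k}"
    proof (intro Collect_cong)
      fix X :: "'n set"
      show "(X \<in> UNIV \<and> ?n - card X = k) = (card X = ?n - k)"
        using le[of X] k by auto
    qed
    then show "(\<Sum>X | X \<in> UNIV \<and> ?n - card X = k. (-1) ^ card X * (\<Prod>a\<in>X. l $ a) * x ^ (?n - card X)) =
        (-1) ^ (?n - k) * esym (?n - k) l * x ^ k"
      using k by (simp add: esym_def sum_distrib_left sum_distrib_right)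
  qed
  finally show ?thesis .
qed

text \<open>Given by its coefficients, from which leading terms cancel; the factored form follows
  from Vieta's formulas.\<close>

definition node_poly :: "complex ^ 'n::finite \<Rightarrow> complex poly" where
  "node_poly l = (\<Sum>k\<le>CARD('n). monom ((-1) ^ (CARD('n) - k) * esym (CARD('n) - k) l) k)"

lemma poly_node_poly: "poly (node_poly l) x = (\<Prod>a\<in>UNIV. x - l $ a)"
  by (simp add: node_poly_def poly_sum poly_monom prod_diff_expand)

lemma coeff_node_poly:
  fixes l :: "complex ^ 'n::finite"
  shows "coeff (node_poly l) k = (if k \<le> CARD('n) then (-1) ^ (CARD('n) - k) * esym (CARD('n) - k) l else 0)"
  by (simp add: node_poly_def coeff_sum)

abbreviation node_deriv :: "complex ^ 'n::finite \<Rightarrow> 'n \<Rightarrow> complex" where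
  "node_deriv l j \<equiv> (\<Prod>a\<in>UNIV - {j}. l $ j - l $ a)"

lemma node_deriv_nonzero:
  "inj (($) l) \<Longrightarrow> node_deriv l j \<noteq> 0"
  by (auto simp: inj_def)

lemma card_range_nth: "inj (($) (l :: complex ^ 'n::finite)) \<Longrightarrow> card (range (($) l)) = CARD('n)"
  by (simp add: card_image)

text \<open>Both sides have degree below \<open>n\<close> and agree at the \<open>n\<close> distinct
  nodes.\<close>

lemma lagrange_interpolation:
  fixes l :: "complex ^ 'n::finite"
  assumes l: "inj (($) l)" and p: "degree p < CARD('n)"
  shows "p = (\<Sum>k\<in>UNIV. smult (poly p (l $ k) / node_deriv l k) (\<Prod>a\<in>UNIV - {k}. [:- l $ a, 1:]))"
    (is "p = ?q")
proof (rule poly_eqI_degree[of "range (($) l)"])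
  have pos: "CARD('n) > 0" by simp
  have "degree (smult c (\<Prod>a\<in>UNIV - {k}. [:- l $ a, 1:])) \<le> CARD('n) - 1" for c k
    by (rule order.trans[OF degree_smult_le], rule order.trans[OF degree_prod_sum_le])
      (auto simp: card_Diff_singleton)
  then have "degree ?q \<le> CARD('n) - 1"
    by (intro degree_sum_le) (simp_all only: finite)
  then show "degree ?q < card (range (($) l))"
    using pos card_range_nth[OF l] by linarith
  show "degree p < card (range (($) l))"
    using p card_range_nth[OF l] by simp
  fix x assume "x \<in> range (($) l)"
  then obtain j where x: "x = l $ j" by blast
  have "poly ?q x = (\<Sum>k\<in>UNIV. poly p (l $ k) / node_deriv l k * (\<Prod>a\<in>UNIV - {k}. l $ j - l $ a))"
    by (simp add: poly_sum poly_prod x)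
  also have "\<dots> = (\<Sum>k\<in>{j}. poly p (l $ k) / node_deriv l k * (\<Prod>a\<in>UNIV - {k}. l $ j - l $ a))"
    by (rule sum.mono_neutral_right) (auto intro!: prod_zero)
  also have "\<dots> = poly p x"
    using node_deriv_nonzero[OF l, of j] by (simp add: x)
  finally show "poly p x = poly ?q x" ..
qed

lemma lagrange_eval:
  fixes l :: "complex ^ 'n::finite"
  assumes "inj (($) l)" and "degree p < CARD('n)"
  shows "poly p y = (\<Sum>k\<in>UNIV. poly p (l $ k) / node_deriv l k * (\<Prod>a\<in>UNIV - {k}. y - l $ a))"
  by (subst lagrange_interpolation[OF assms]) (simp add: poly_sum poly_prod)

text \<open>Each interpolation product is monic of degree \<open>n - 1\<close>, so only the weights
  remain; their sum is the divided difference of \<open>p\<close> at all nodes.\<close>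

lemma lagrange_top_coeff:
  fixes l :: "complex ^ 'n::finite"
  assumes "inj (($) l)" and "degree p < CARD('n)"
  shows "coeff p (CARD('n) - 1) = (\<Sum>k\<in>UNIV. poly p (l $ k) / node_deriv l k)"
proof -
  have "coeff (\<Prod>a\<in>UNIV - {k}. [:- l $ a, 1:]) (CARD('n) - 1) = 1" for k
  proof -
    let ?r = "\<Prod>a\<in>UNIV - {k}. [:- l $ a, 1:]"
    have "degree ?r = CARD('n) - 1"
      by (subst degree_prod_eq_sum_degree) (auto simp: card_Diff_singleton)
    moreover have "lead_coeff ?r = 1" by (simp add: lead_coeff_prod)
    ultimately show ?thesis by simp
  qed
  then show ?thesis
    by (subst lagrange_interpolation[OF assms]) (simp add: coeff_sum)
qed

text \<open>With \<open>y = l $ j + \<phi>\<close>, each entry of \<open>K\<close> becomes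
  \<open>P(y) / P'(l $ j)\<close> times \<open>1 / (y - l $ k) - 1 / u\<close>. The first part is
  the interpolation product for node \<open>k\<close> and reproduces \<open>p\<close> at
  \<open>y\<close>; the second sums to the top coefficient.\<close>

lemma interpolation_K:
  fixes l :: "complex ^ 'n::finite"
  assumes l: "inj (($) l)" and p: "degree p < CARD('n)"
    and y: "\<And>a. \<phi> - (l $ a - l $ j) \<noteq> 0" and u: "u \<noteq> 0"
  shows "(\<Sum>k\<in>UNIV. poly p (l $ k) / node_deriv l k *
      (\<phi> * (1 / (\<phi> - (l $ k - l $ j)) - 1 / u) * (\<Prod>a\<in>UNIV - {j}. 1 + \<phi> / (l $ j - l $ a)))) =
    (poly p (l $ j + \<phi>) - coeff p (CARD('n) - 1) * poly (node_poly l) (l $ j + \<phi>) / u) / node_deriv l j"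
proof -
  define y where "y = l $ j + \<phi>"
  have ne: "y - l $ a \<noteq> 0" for a using y[of a] by (simp add: y_def algebra_simps)
  have split: "poly (node_poly l) y = (y - l $ k) * (\<Prod>a\<in>UNIV - {k}. y - l $ a)" for k
    by (simp add: poly_node_poly prod.remove[of UNIV k])
  have "(\<Prod>a\<in>UNIV - {j}. 1 + \<phi> / (l $ j - l $ a)) = (\<Prod>a\<in>UNIV - {j}. (y - l $ a) / (l $ j - l $ a))"
  proof (intro prod.cong refl)
    fix a assume "a \<in> UNIV - {j}"
    then have "l $ j - l $ a \<noteq> 0" using l by (auto simp: inj_def)
    then show "1 + \<phi> / (l $ j - l $ a) = (y - l $ a) / (l $ j - l $ a)"
      by (simp add: y_def field_simps)
  qed
  also have "\<dots> = (\<Prod>a\<in>UNIV - {j}. y - l $ a) / node_deriv l j"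
    by (simp add: prod_dividef)
  \<comment> \<open>The factor of \<open>P(y)\<close> missing from the product is
    \<open>y - l $ j\<close>, which is \<open>\<phi>\<close>.\<close>
  finally have prod: "\<phi> * (\<Prod>a\<in>UNIV - {j}. 1 + \<phi> / (l $ j - l $ a)) = poly (node_poly l) y / node_deriv l j"
    using split[of j] by (simp add: y_def)
  have "\<phi> * (1 / (\<phi> - (l $ k - l $ j)) - 1 / u) * (\<Prod>a\<in>UNIV - {j}. 1 + \<phi> / (l $ j - l $ a)) =
      ((\<Prod>a\<in>UNIV - {k}. y - l $ a) - poly (node_poly l) y / u) / node_deriv l j" (is "?lhs = ?rhs") for k
  proof -
    have "?lhs = (1 / (y - l $ k) - 1 / u) * (\<phi> * (\<Prod>a\<in>UNIV - {j}. 1 + \<phi> / (l $ j - l $ a)))"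
      by (simp add: y_def algebra_simps)
    also have "\<dots> = (1 / (y - l $ k) - 1 / u) * poly (node_poly l) y / node_deriv l j"
      by (simp only: prod times_divide_eq_right)
    also have "(1 / (y - l $ k) - 1 / u) * poly (node_poly l) y =
        (\<Prod>a\<in>UNIV - {k}. y - l $ a) - poly (node_poly l) y / u"
    proof -
      have "1 / (y - l $ k) * poly (node_poly l) y = (\<Prod>a\<in>UNIV - {k}. y - l $ a)"
        unfolding split[of k] using ne[of k] by simp
      then show ?thesis by (simp add: left_diff_distrib)
    qed
    finally show ?thesis .
  qed
  then have "(\<Sum>k\<in>UNIV. poly p (l $ k) / node_deriv l k *
      (\<phi> * (1 / (\<phi> - (l $ k - l $ j)) - 1 / u) * (\<Prod>a\<in>UNIV - {j}. 1 + \<phi> / (l $ j - l $ a)))) =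
    (\<Sum>k\<in>UNIV. poly p (l $ k) / node_deriv l k *
      (((\<Prod>a\<in>UNIV - {k}. y - l $ a) - poly (node_poly l) y / u) / node_deriv l j))"
    by simp
  also have "\<dots> = ((\<Sum>k\<in>UNIV. poly p (l $ k) / node_deriv l k * (\<Prod>a\<in>UNIV - {k}. y - l $ a)) -
      (\<Sum>k\<in>UNIV. poly p (l $ k) / node_deriv l k) * (poly (node_poly l) y / u)) / node_deriv l j"
    by (simp add: sum_distrib_right sum_divide_distrib sum_subtractf diff_divide_distrib right_diff_distrib mult.assoc)
  also have "\<dots> = (poly p y - coeff p (CARD('n) - 1) * poly (node_poly l) y / u) / node_deriv l j"
    by (simp only: lagrange_eval[OF l p, of y] lagrange_top_coeff[OF l p] times_divide_eq_right)
  finally show ?thesis by (simp add: y_def)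
qed

section \<open>The rows of \<open>b\<close>\<close>

text \<open>Row \<open>i\<close> of \<open>b\<^sup>g\<close> consists of the values of \<open>row_fun\<close> at the nodes, up to the
  interpolation weights and the factor \<open>1 / (\<sigma> + u - \<gamma> + f\<^sub>0)\<close> of the last row. For the last row
  \<open>row_fun\<close> has degree \<open>n\<close>; adding \<open>node_poly\<close> lowers the degree without changing these values.\<close>

definition row_fun :: "complex \<Rightarrow> complex ^ 'n::finite \<Rightarrow> nat \<Rightarrow> complex \<Rightarrow> complex" where
  "row_fun u l i x = (if i < CARD('n) then x ^ (i - 1) else x ^ (CARD('n) - 1) * (sigma l - x + u))"

definition row_poly :: "complex \<Rightarrow> complex ^ 'n::finite \<Rightarrow> nat \<Rightarrow> complex poly" where
  "row_poly u l i = (if i < CARD('n) then monom 1 (i - 1)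
     else monom (sigma l + u) (CARD('n) - 1) - monom 1 (CARD('n)) + node_poly l)"

lemma poly_row_poly:
  fixes l :: "complex ^ 'n::finite"
  shows "poly (row_poly u l i) x = row_fun u l i x + (if i < CARD('n) then 0 else poly (node_poly l) x)"
  by (simp add: row_poly_def row_fun_def poly_monom algebra_simps power_eq_if[of x "CARD('n)"])

lemma poly_row_poly_node: "poly (row_poly u l i) (l $ k) = row_fun u l i (l $ k)"
  by (auto simp: poly_row_poly poly_node_poly intro!: prod_zero)

text \<open>In the last row \<open>- x ^ n\<close> cancels against the leading term of the monic
  \<open>node_poly\<close>.\<close>

lemma degree_row_poly:
  fixes l :: "complex ^ 'n::finite"
  shows "degree (row_poly u l i) < CARD('n)"
proof (rule degree_lessI)
  show "row_poly u l i \<noteq> 0 \<or> CARD('n) > 0" by simp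
  have pos: "CARD('n) > 0" by simp
  show "\<forall>k\<ge>CARD('n). coeff (row_poly u l i) k = 0"
  proof (intro allI impI)
    fix k assume k: "CARD('n) \<le> k"
    then have "k \<noteq> i - 1" if "i < CARD('n)" using that by linarith
    moreover have "CARD('n) - 1 \<noteq> k" using k pos by linarith
    ultimately show "coeff (row_poly u l i) k = 0"
      using k by (auto simp: row_poly_def coeff_node_poly esym_0)
  qed
qed

text \<open>In the last row the monomial contributes \<open>sigma l + u\<close> and
  \<open>node_poly\<close> contributes \<open>- sigma l\<close>.\<close>

lemma top_coeff_row_poly:
  fixes l :: "complex ^ 'n::finite"
  assumes "i \<ge> 1"
  shows "coeff (row_poly u l i) (CARD('n) - 1) = (if i < CARD('n) then 0 else u)"
proof -
  have pos: "CARD('n) > 0" by simp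
  then have "CARD('n) - (CARD('n) - 1) = Suc 0" "CARD('n) \<noteq> CARD('n) - 1" by linarith+
  \<comment> \<open>The bound \<open>i \<ge> 1\<close> excludes \<open>i = 0\<close> with a single
    node, where the truncated \<open>i - 1\<close> would equal \<open>n - 1\<close>.\<close>
  moreover have "i - 1 \<noteq> CARD('n) - 1" if "i < CARD('n)" using assms that by linarith
  ultimately show ?thesis
    by (simp add: row_poly_def coeff_node_poly esym_1)
qed

text \<open>In the last row the top coefficient \<open>u\<close> cancels \<open>1 / u\<close>, so
  exactly the added value of \<open>node_poly\<close> at the shifted point is subtracted
  again.\<close>

lemma row_fun_K:
  fixes l :: "complex ^ 'n::finite"
  assumes l: "inj (($) l)" and y: "\<And>a. \<phi> - (l $ a - l $ j) \<noteq> 0" and u: "u \<noteq> 0" and i: "i \<ge> 1"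
  shows "(\<Sum>k\<in>UNIV. row_fun u l i (l $ k) / node_deriv l k *
      (\<phi> * (1 / (\<phi> - (l $ k - l $ j)) - 1 / u) * (\<Prod>a\<in>UNIV - {j}. 1 + \<phi> / (l $ j - l $ a)))) =
    row_fun u l i (l $ j + \<phi>) / node_deriv l j"
  unfolding interpolation_K[OF l degree_row_poly y u, of u l i, unfolded poly_row_poly_node]
    top_coeff_row_poly[OF i] poly_row_poly
  using u by simp

section \<open>Reindexing by \<open>idx\<close>\<close>

lemma idx_less: "i < j \<Longrightarrow> idx i < idx (j :: 'n::{finite,linorder})"
  unfolding idx_def by (rule psubset_card_mono) auto

lemma idx_less_iff: "idx i < idx j \<longleftrightarrow> i < (j :: 'n::{finite,linorder})"
  by (metis idx_less linorder_less_linear order_less_asym order_less_irrefl)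

lemma inj_idx: "inj (idx :: 'n::{finite,linorder} \<Rightarrow> nat)"
  by (metis idx_less injI linorder_less_linear order_less_irrefl)

lemma idx_bounds: "1 \<le> idx i" "idx (i :: 'n::{finite,linorder}) \<le> CARD('n)"
proof -
  have "card {..i} \<noteq> 0" by (simp add: card_eq_0_iff)
  then show "1 \<le> idx i" unfolding idx_def by linarith
qed (simp add: idx_def card_mono)

lemma range_idx: "range (idx :: 'n::{finite,linorder} \<Rightarrow> nat) = {1..CARD('n)}"
  by (rule card_subset_eq) (auto simp: idx_bounds[unfolded One_nat_def] card_image inj_idx)

lemma sum_idx:
  fixes h :: "nat \<Rightarrow> complex"
  shows "(\<Sum>k\<in>UNIV. h (idx (k :: 'n::{finite,linorder}))) = (\<Sum>m<CARD('n). h (Suc m))"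
proof -
  have "(\<Sum>k\<in>UNIV. h (idx (k :: 'n))) = sum h {1..CARD('n)}"
    using sum.reindex[OF inj_idx[where 'n = 'n], of h] by (simp add: range_idx)
  also have "\<dots> = (\<Sum>m<CARD('n). h (Suc m))"
    by (simp add: sum.shift_bounds_Suc_ivl lessThan_atLeast0 atLeastLessThanSuc_atLeastAtMost
        flip: sum.shift_bounds_Suc_ivl)
  finally show ?thesis .
qed

section \<open>The rows of \<open>Q\<close>\<close>

lemma binomial_row:
  fixes x \<phi> :: complex
  shows "(\<Sum>m\<le>N. of_nat (N choose (N - m)) * \<phi> ^ (N - m) * x ^ m) = (x + \<phi>) ^ N"
  unfolding binomial_ring by (rule sum.cong) (auto simp: binomial_symmetric[symmetric] mult_ac)

text \<open>Up to denominators this is the last row of \<open>Q\<close> with the diagonal term moved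
  to the right. The three terms of \<open>M_coeff\<close> give truncated expansions of
  \<open>(x + f l) ^ (n - 1)\<close>, of \<open>(x + f l) ^ n\<close> and of
  \<open>P(x) = 0\<close>.\<close>

lemma M_coeff_row:
  fixes l :: "complex ^ 'n::finite"
  assumes x: "poly (node_poly l) x = 0"
  shows "(\<Sum>m<CARD('n) - 1. M_coeff f u l (Suc m) * x ^ m) =
    u * row_fun u l (CARD('n)) (x + f l) - (u - of_nat CARD('n) * f l) * row_fun u l (CARD('n)) x"
proof -
  obtain N where N: "CARD('n) = Suc N"
    by (metis not0_implies_Suc zero_less_card_finite less_irrefl)
  define \<phi> where "\<phi> = f l"
  have "(\<Sum>m<N. of_nat (N choose (N - m)) * \<phi> ^ (N - m) * x ^ m) + x ^ N = (x + \<phi>) ^ N"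
    by (simp add: lessThan_Suc_atMost[symmetric] flip: binomial_row)
  then have S1: "(\<Sum>m<N. of_nat (N choose (N - m)) * \<phi> ^ (N - m) * x ^ m) = (x + \<phi>) ^ N - x ^ N"
    by (simp add: algebra_simps)
  \<comment> \<open>The terms \<open>m = N\<close> and \<open>m = N + 1\<close> of the binomial sum
    are split off, since \<open>M_coeff\<close> covers only \<open>m < N\<close>.\<close>
  have "(\<Sum>m<N. of_nat (Suc N choose (Suc N - m)) * \<phi> ^ (Suc N - m) * x ^ m) + of_nat (Suc N) * \<phi> * x ^ N
      + x ^ Suc N = (x + \<phi>) ^ Suc N"
    by (simp add: lessThan_Suc_atMost[symmetric] Suc_diff_le del: binomial_Suc_Suc power_Suc of_nat_Suc
        flip: binomial_row)
  then have S2: "(\<Sum>m<N. of_nat (Suc N choose (Suc N - m)) * \<phi> ^ (Suc N - m) * x ^ m) =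
      (x + \<phi>) ^ Suc N - x ^ Suc N - of_nat (Suc N) * \<phi> * x ^ N"
    by (simp add: algebra_simps)
  \<comment> \<open>This is \<open>P(x) = 0\<close> with its two top terms split off.\<close>
  have "(\<Sum>m<N. (-1) ^ (Suc N - m) * esym (Suc N - m) l * x ^ m) - sigma l * x ^ N + x ^ Suc N = 0"
    using x unfolding poly_node_poly prod_diff_expand N
    by (simp add: lessThan_Suc_atMost[symmetric] Suc_diff_le esym_0 esym_1 del: power_Suc)
  then have S3: "(\<Sum>m<N. (-1) ^ (Suc N - m) * esym (Suc N - m) l * x ^ m) = sigma l * x ^ N - x ^ Suc N"
    by (simp add: algebra_simps)
  have "(\<Sum>m<N. M_coeff f u l (Suc m) * x ^ m) =
      (\<Sum>m<N. u * (u + sigma l) * (of_nat (N choose (N - m)) * \<phi> ^ (N - m) * x ^ m)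
        - u * (of_nat (Suc N choose (Suc N - m)) * \<phi> ^ (Suc N - m) * x ^ m)
        + of_nat (Suc N) * \<phi> * ((-1) ^ (Suc N - m) * esym (Suc N - m) l * x ^ m))"
    by (rule sum.cong)
      (auto simp: M_coeff_def Let_def N L_set_def esym_def \<phi>_def Suc_diff_le algebra_simps
        simp del: binomial_Suc_Suc of_nat_Suc power_Suc)
  also have "\<dots> = u * (u + sigma l) * ((x + \<phi>) ^ N - x ^ N)
      - u * ((x + \<phi>) ^ Suc N - x ^ Suc N - of_nat (Suc N) * \<phi> * x ^ N)
      + of_nat (Suc N) * \<phi> * (sigma l * x ^ N - x ^ Suc N)"
    by (simp only: sum.distrib sum_subtractf S1 S2 S3 flip: sum_distrib_left)
  also have "\<dots> = u * row_fun u l (CARD('n)) (x + \<phi>) - (u - of_nat CARD('n) * \<phi>) * row_fun u l (CARD('n)) x"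
    by (simp add: row_fun_def N algebra_simps del: of_nat_Suc)
  finally show ?thesis by (simp add: N \<phi>_def)
qed

section \<open>Entries of the products of b^g with K and Q\<close>

definition row_factor :: "complex \<Rightarrow> complex \<Rightarrow> complex \<Rightarrow> complex ^ 'n::finite \<Rightarrow> nat \<Rightarrow> complex" where
  "row_factor \<gamma> f0 u l i = (if i < CARD('n) then 1 else 1 / (sigma l + (u - \<gamma>) + f0))"

text \<open>Replacing \<open>u\<close> by \<open>u - \<gamma>\<close> cancels the
  \<open>\<gamma>\<close> in the numerator of the last row, so \<open>\<gamma>\<close> survives only
  in \<open>row_factor\<close>.\<close>

lemma bg_mat_nth:
  "bg_mat \<gamma> f0 u l $ i $ j = row_factor \<gamma> f0 u l (idx i) * (row_fun u l (idx i) (l $ j) / node_deriv l j)"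
  by (simp add: bg_mat_def b_mat_def row_factor_def row_fun_def)

lemma bg_mat_K_mat:
  fixes l :: "complex ^ 'n::{finite,linorder}"
  assumes l: "inj (($) l)" and y: "\<And>a. f l - (l $ a - l $ j) \<noteq> 0" and u: "u \<noteq> 0"
  shows "(bg_mat \<gamma> f0 u l ** K_mat f u l) $ i $ j =
    row_factor \<gamma> f0 u l (idx i) * (row_fun u l (idx i) (l $ j + f l) / node_deriv l j)"
  unfolding row_fun_K[OF l y u idx_bounds(1), symmetric]
  by (simp add: matrix_matrix_mult_def bg_mat_nth K_mat_def sum_distrib_left mult.assoc)

text \<open>For \<open>idx i < n\<close> this is the binomial theorem; the last row is
  \<open>M_coeff_row\<close> divided by \<open>u\<close> and by the denominator shared with
  \<open>row_factor\<close>.\<close>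

lemma Q_mat_row:
  fixes l :: "complex ^ 'n::{finite,linorder}"
  assumes x: "poly (node_poly l) x = 0" and u: "u \<noteq> 0"
  shows "(\<Sum>k\<in>UNIV. Q_mat \<gamma> f0 f u l $ i $ k * (row_factor \<gamma> f0 u l (idx k) * row_fun u l (idx k) x)) =
    row_factor \<gamma> f0 u l (idx i) * row_fun u l (idx i) (x + f l)"
proof (cases "idx i < CARD('n)")
  case True
  obtain N where N: "idx i = Suc N" using idx_bounds(1)[of i] by (cases "idx i") auto
  \<comment> \<open>The default 0 matters: above the diagonal \<open>Suc N - m\<close> truncates to
    0, and the formula would give \<open>x ^ (m - 1)\<close>.\<close>
  define h where "h m = (if m \<le> Suc N then of_nat (N choose (Suc N - m)) * f l ^ (Suc N - m) * x ^ (m - 1) else 0)" for m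
  have "Q_mat \<gamma> f0 f u l $ i $ k * (row_factor \<gamma> f0 u l (idx k) * row_fun u l (idx k) x) = h (idx k)" for k
  proof (cases k i rule: linorder_cases)
    case less
    then show ?thesis using True idx_less[OF less] N
      by (simp add: Q_mat_def row_factor_def row_fun_def h_def)
  next
    case equal
    then show ?thesis using True N
      by (simp add: Q_mat_def row_factor_def row_fun_def h_def)
  next
    case greater
    then show ?thesis using idx_less[OF greater] N
      by (auto simp: Q_mat_def h_def)
  qed
  then have "(\<Sum>k\<in>UNIV. Q_mat \<gamma> f0 f u l $ i $ k * (row_factor \<gamma> f0 u l (idx k) * row_fun u l (idx k) x)) =
      (\<Sum>k\<in>(UNIV::'n set). h (idx k))" by simp
  also have "\<dots> = (\<Sum>m<CARD('n). h (Suc m))" by (rule sum_idx)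
  also have "\<dots> = (\<Sum>m\<le>N. h (Suc m))"
    using True N by (intro sum.mono_neutral_right) (auto simp: h_def)
  also have "\<dots> = (x + f l) ^ N"
    unfolding binomial_row[symmetric] by (rule sum.cong) (auto simp: h_def)
  finally show ?thesis using True N by (simp add: row_factor_def row_fun_def)
next
  case False
  then have i: "idx i = CARD('n)" using idx_bounds(2)[of i] by simp
  define D where "D = sigma l + (u - \<gamma>) + f0"
  have D: "u + sigma l - \<gamma> + f0 = D" by (simp add: D_def)
  define r where "r = row_fun u l (CARD('n))"
  define h where "h m = (if m < CARD('n) then M_coeff f u l m / (u * D) * x ^ (m - 1)
      else (1 - of_nat CARD('n) * f l / u) * (1 / D * r x))" for m
  have "Q_mat \<gamma> f0 f u l $ i $ k * (row_factor \<gamma> f0 u l (idx k) * row_fun u l (idx k) x) = h (idx k)" for k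
  proof (cases "k = i")
    case True
    then show ?thesis using i by (simp add: Q_mat_def row_factor_def h_def D_def r_def)
  next
    case False
    then have "idx k < CARD('n)"
      using i idx_bounds(2)[of k] inj_idx by (metis injD le_neq_implies_less)
    moreover from this have "k < i" using i idx_less_iff by metis
    ultimately show ?thesis
      using i D \<open>k \<noteq> i\<close> by (auto simp: Q_mat_def row_factor_def row_fun_def h_def)
  qed
  then have "(\<Sum>k\<in>UNIV. Q_mat \<gamma> f0 f u l $ i $ k * (row_factor \<gamma> f0 u l (idx k) * row_fun u l (idx k) x)) =
      (\<Sum>k\<in>(UNIV::'n set). h (idx k))" by simp
  also have "\<dots> = (\<Sum>m<CARD('n). h (Suc m))" by (rule sum_idx)
  also have "\<dots> = (\<Sum>m<CARD('n) - 1. h (Suc m)) + h (CARD('n))"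
  proof -
    obtain N where "CARD('n) = Suc N"
      by (metis not0_implies_Suc zero_less_card_finite less_irrefl)
    then show ?thesis by simp
  qed
  also have "(\<Sum>m<CARD('n) - 1. h (Suc m)) = (\<Sum>m<CARD('n) - 1. M_coeff f u l (Suc m) * x ^ m) / (u * D)"
    unfolding sum_divide_distrib by (rule sum.cong) (auto simp: h_def)
  also have "\<dots> = (u * r (x + f l) - (u - of_nat CARD('n) * f l) * r x) / (u * D)"
    by (simp only: M_coeff_row[OF x] r_def)
  \<comment> \<open>If \<open>D = 0\<close>, both sides are 0 because division by zero gives
    0.\<close>
  also have "\<dots> + h (CARD('n)) = 1 / D * r (x + f l)"
    using u by (cases "D = 0") (simp_all add: h_def field_simps)
  finally show ?thesis by (simp add: i row_factor_def r_def D_def)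
qed

lemma Q_mat_bg_mat:
  fixes l :: "complex ^ 'n::{finite,linorder}"
  assumes u: "u \<noteq> 0"
  shows "(Q_mat \<gamma> f0 f u l ** bg_mat \<gamma> f0 u l) $ i $ j =
    row_factor \<gamma> f0 u l (idx i) * (row_fun u l (idx i) (l $ j + f l) / node_deriv l j)"
proof -
  have "poly (node_poly l) (l $ j) = 0"
    unfolding poly_node_poly by (rule prod_zero) auto
  from Q_mat_row[OF this u, of \<gamma> f0 f i] show ?thesis
    by (simp add: matrix_matrix_mult_def bg_mat_nth sum_divide_distrib[symmetric] mult.assoc)
qed

text \<open>A linear relation between the rows gives a combination \<open>H\<close> of the row
  polynomials that has degree below \<open>n\<close> and vanishes at all \<open>n\<close> nodes,
  hence is zero. Comparing coefficients, first at \<open>x ^ (n - 1)\<close>, then at lower powers,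
  kills all weights.\<close>

lemma invertible_bg_mat:
  fixes l :: "complex ^ 'n::{finite,linorder}"
  assumes l: "inj (($) l)" and u: "u \<noteq> 0" and D: "sigma l + (u - \<gamma>) + f0 \<noteq> 0"
  shows "invertible (bg_mat \<gamma> f0 u l)"
  unfolding invertible_right_inverse matrix_right_invertible_independent_rows
proof (intro allI impI)
  fix c and i :: 'n
  assume c: "(\<Sum>i\<in>UNIV. c i *s row i (bg_mat \<gamma> f0 u l)) = 0"
  \<comment> \<open>The row factors, nonzero by \<open>D\<close>, are absorbed into the
    weights.\<close>
  define d where "d i = c i * row_factor \<gamma> f0 u l (idx i)" for i :: 'n
  define H where "H = (\<Sum>i\<in>UNIV. smult (d i) (row_poly u l (idx (i::'n))))"
  have "degree (smult (d i) (row_poly u l (idx i))) \<le> CARD('n) - 1" for i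
    using degree_row_poly[of u l "idx i"] degree_smult_le[of "d i" "row_poly u l (idx i)"] by linarith
  then have "degree H \<le> CARD('n) - 1"
    unfolding H_def by (intro degree_sum_le) auto
  moreover have "CARD('n) > 0" by simp
  ultimately have degH: "degree H < CARD('n)" by linarith
  have "poly H (l $ j) = 0" for j
  proof -
    have "0 = (\<Sum>i\<in>UNIV. c i * bg_mat \<gamma> f0 u l $ i $ j)"
      using arg_cong[OF c, of "\<lambda>v. v $ j"] by (simp add: row_def)
    also have "\<dots> = poly H (l $ j) / node_deriv l j"
      by (simp add: H_def poly_sum bg_mat_nth poly_row_poly_node d_def sum_divide_distrib mult_ac)
    finally show ?thesis using node_deriv_nonzero[OF l, of j] by simp
  qed
  then have H0: "H = 0"
    by (intro poly_eqI_degree[of "range (($) l)"]) (use degH in \<open>auto simp: card_range_nth[OF l]\<close>)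
  \<comment> \<open>Only the last row polynomial contains \<open>x ^ (n - 1)\<close>, with
    coefficient \<open>u\<close>.\<close>
  have last: "d i = 0" if i: "idx i = CARD('n)" for i :: 'n
  proof -
    have "0 = (\<Sum>k\<in>UNIV. d k * coeff (row_poly u l (idx k)) (CARD('n) - 1))"
      using arg_cong[OF H0, of "\<lambda>p. coeff p (CARD('n) - 1)"] by (simp add: H_def coeff_sum)
    also have "\<dots> = (\<Sum>k\<in>{i}. d k * coeff (row_poly u l (idx k)) (CARD('n) - 1))"
    proof (rule sum.mono_neutral_right)
      show "\<forall>k\<in>UNIV - {i}. d k * coeff (row_poly u l (idx k)) (CARD('n) - 1) = 0"
      proof
        fix k :: 'n assume "k \<in> UNIV - {i}"
        then have "idx k < CARD('n)"
          using i idx_bounds(2)[of k] inj_idx by (metis DiffD2 injD le_neq_implies_less singletonI)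
        then show "d k * coeff (row_poly u l (idx k)) (CARD('n) - 1) = 0"
          by (simp only: top_coeff_row_poly[OF idx_bounds(1)] if_True mult_zero_right)
      qed
    qed auto
    also have "\<dots> = d i * u"
      using top_coeff_row_poly[OF idx_bounds(1)[of i], of u l] i by simp
    finally show ?thesis using u by simp
  qed
  have "d i = 0"
  proof (cases "idx i < CARD('n)")
    case True
    have "0 = (\<Sum>k\<in>UNIV. d k * coeff (row_poly u l (idx k)) (idx i - 1))"
      using arg_cong[OF H0, of "\<lambda>p. coeff p (idx i - 1)"] by (simp add: H_def coeff_sum)
    also have "\<dots> = (\<Sum>k\<in>{i}. d k * coeff (row_poly u l (idx k)) (idx i - 1))"
    proof (rule sum.mono_neutral_right)
      show "\<forall>k\<in>UNIV - {i}. d k * coeff (row_poly u l (idx k)) (idx i - 1) = 0"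
      proof
        fix k :: 'n assume "k \<in> UNIV - {i}"
        then have "idx k \<noteq> idx i" using inj_idx by (auto dest: injD)
        then have "idx k - 1 \<noteq> idx i - 1" using idx_bounds(1)[of k] idx_bounds(1)[of i] by linarith
        \<comment> \<open>The last row polynomial may contain the power \<open>idx i - 1\<close>,
          but its weight already vanishes.\<close>
        moreover have "d k = 0" if "\<not> idx k < CARD('n)"
          using last[of k] that idx_bounds(2)[of k] by simp
        ultimately show "d k * coeff (row_poly u l (idx k)) (idx i - 1) = 0"
          by (auto simp: row_poly_def)
      qed
    qed auto
    also have "\<dots> = d i" using True by (simp add: row_poly_def)
    finally show ?thesis by simp
  next
    case False
    then show ?thesis using last[of i] idx_bounds(2)[of i] by simp
  qed
  then show "c i = 0" using D by (auto simp: d_def row_factor_def split: if_splits)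
qed

section \<open>The factorization\<close>

lemma reindex_Some: "reindex Some 0 z = (\<chi> i. z $ Some i)"
  by (simp add: reindex_def)

lemma generically_joint:
  fixes P :: "complex ^ 'n::finite \<Rightarrow> bool"
  shows "generically P \<Longrightarrow> generically (joint (\<lambda>u. P))"
  using generically_reindex[of Some P 0] by (simp add: reindex_Some joint_def[abs_def])

lemma meromorphic_sv_joint:
  fixes F :: "complex ^ 'n::finite \<Rightarrow> complex"
  shows "meromorphic_sv F \<Longrightarrow> meromorphic_sv (joint (\<lambda>u. F))"
  using meromorphic_sv_reindex[of Some F 0] by (simp add: reindex_Some joint_def[abs_def])

lemma meromorphic_sv_K_mat:
  fixes f :: "complex ^ 'n::finite \<Rightarrow> complex"
  assumes "meromorphic_sv f"
  shows "meromorphic_sv (joint (\<lambda>u l. K_mat f u l $ i $ j))"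
  using meromorphic_sv_joint[OF assms] unfolding joint_def K_mat_def vec_lambda_beta
  by (intro meromorphic_sv_mult meromorphic_sv_diff meromorphic_sv_divide meromorphic_sv_prod
      meromorphic_sv_add meromorphic_sv_const meromorphic_sv_nth)

text \<open>By the dichotomy for meromorphic functions, failure means that \<open>f\<close> equals
  the difference generically. For \<open>i \<noteq> j\<close>, translation by
  \<open>axis i \<gamma>\<close> fixes \<open>f\<close> but changes the difference by
  \<open>\<gamma>\<close>; one point where all three generic equations hold suffices.\<close>

lemma generically_periodic_ne_diff:
  fixes f :: "complex ^ 'n::finite \<Rightarrow> complex"
  assumes \<gamma>: "\<gamma> \<noteq> 0" and f: "meromorphic_sv f"
    and per: "\<And>i. meromorphic_eq (\<lambda>l. f (l + axis i \<gamma>)) f"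
    and nz: "\<not> meromorphic_eq f (\<lambda>l. 0)"
  shows "generically (\<lambda>l. f l - (l $ i - l $ j) \<noteq> 0)"
proof -
  have "meromorphic_sv (\<lambda>l. f l - (l $ i - l $ j))"
    by (intro meromorphic_sv_diff f meromorphic_sv_nth)
  moreover have "\<not> generically (\<lambda>l. f l - (l $ i - l $ j) = 0)"
  proof
    assume *: "generically (\<lambda>l. f l - (l $ i - l $ j) = 0)"
    show False
    proof (cases "i = j")
      case True
      moreover have "meromorphic_sv (\<lambda>l :: complex ^ 'n. 0)"
        by (rule meromorphic_sv_const)
      ultimately show False
        using * nz f by (simp add: meromorphic_eq_def)
    next
      case False
      have shift: "reindex id v l = l + v" for v l :: "complex ^ 'n"
        by (simp add: reindex_def vec_eq_iff)
      have "generically (\<lambda>l. f (l + axis i \<gamma>) - ((l + axis i \<gamma>) $ i - (l + axis i \<gamma>) $ j) = 0)"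
        using generically_reindex[OF inj_on_id *, of "axis i \<gamma>"] by (simp only: shift)
      moreover have "generically (\<lambda>l. f (l + axis i \<gamma>) = f l)"
        using per by (simp add: meromorphic_eq_def)
      ultimately have "generically (\<lambda>l. f l - (l $ i - l $ j) = 0 \<and>
          f (l + axis i \<gamma>) - ((l + axis i \<gamma>) $ i - (l + axis i \<gamma>) $ j) = 0 \<and> f (l + axis i \<gamma>) = f l)"
        by (intro generically_conj *)
      then obtain l where "f l - (l $ i - l $ j) = 0" "f (l + axis i \<gamma>) = f l"
          "f (l + axis i \<gamma>) - ((l + axis i \<gamma>) $ i - (l + axis i \<gamma>) $ j) = 0"
        using generically_ex by blast
      then have "\<gamma> = 0" using False by (simp add: axis_def algebra_simps)
      with \<gamma> show False ..
    qed
  qed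
  ultimately show ?thesis using meromorphic_sv_zero_or_nonzero by blast
qed

lemma generically_regular:
  fixes f :: "complex ^ 'n::finite \<Rightarrow> complex"
  assumes "\<gamma> \<noteq> 0" "meromorphic_sv f" "\<And>i. meromorphic_eq (\<lambda>l. f (l + axis i \<gamma>)) f"
    "\<not> meromorphic_eq f (\<lambda>l. 0)"
  shows "generically (joint (\<lambda>u l.
     u \<noteq> 0 \<and> sigma l + (u - \<gamma>) + f0 \<noteq> 0 \<and> (\<forall>i j. i \<noteq> j \<longrightarrow> l $ i - l $ j \<noteq> 0) \<and>
     (\<forall>i j. f l - (l $ i - l $ j) \<noteq> 0)))"
proof -
  have 1: "generically (\<lambda>z :: complex ^ 'n option. z $ None \<noteq> 0)"
    by (rule generically_nonzero[of _ "axis None 1"]) (auto simp: holomorphic_sv_nth)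
  have 2: "generically (\<lambda>z :: complex ^ 'n option. (\<Sum>k\<in>UNIV. z $ Some k) + (z $ None - \<gamma>) + f0 \<noteq> 0)"
    \<comment> \<open>At this witness all \<lambda> components are 0 and the expression equals
      1.\<close>
    by (rule generically_nonzero[of _ "axis None (1 + \<gamma> - f0)"])
      (auto simp: axis_def intro!: holomorphic_sv_add holomorphic_sv_minus holomorphic_sv_nth
        holomorphic_sv_const holomorphic_sv_sum)
  have 3: "generically (\<lambda>l :: complex ^ 'n. \<forall>i j. i \<noteq> j \<longrightarrow> l $ i - l $ j \<noteq> 0)"
  proof (intro generically_all)
    fix i j :: 'n
    show "generically (\<lambda>l :: complex ^ 'n. i \<noteq> j \<longrightarrow> l $ i - l $ j \<noteq> 0)"
    proof (cases "i = j")
      case False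
      then have "generically (\<lambda>l :: complex ^ 'n. l $ i - l $ j \<noteq> 0)"
        by (intro generically_nonzero[of _ "axis i 1"] holomorphic_sv_minus holomorphic_sv_nth)
          (simp add: axis_def)
      then show ?thesis by (rule generically_mono) simp
    qed (simp add: generically_True)
  qed
  have 4: "generically (\<lambda>l :: complex ^ 'n. \<forall>i j. f l - (l $ i - l $ j) \<noteq> 0)"
    by (intro generically_all generically_periodic_ne_diff[OF assms])
  show ?thesis
    using generically_conj[OF 1 generically_conj[OF 2
      generically_conj[OF generically_joint[OF 3] generically_joint[OF 4]]]]
    by (simp add: joint_def[abs_def] sigma_def)
qed

lemma matrix_inv_mult_self: "invertible A \<Longrightarrow> matrix_inv A ** A = mat 1"
  unfolding invertible_def matrix_inv_def by (rule someI2_ex) auto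

lemma K_mat_factorization:
  fixes l :: "complex ^ 'n::{finite,linorder}"
  assumes l: "inj (($) l)" and y: "\<And>i j. f l - (l $ i - l $ j) \<noteq> 0" and u: "u \<noteq> 0"
    and inv: "invertible (bg_mat \<gamma> f0 u l)"
  shows "K_mat f u l = matrix_inv (bg_mat \<gamma> f0 u l) ** Q_mat \<gamma> f0 f u l ** bg_mat \<gamma> f0 u l"
proof -
  have "bg_mat \<gamma> f0 u l ** K_mat f u l = Q_mat \<gamma> f0 f u l ** bg_mat \<gamma> f0 u l"
    unfolding vec_eq_iff bg_mat_K_mat[where f = f, OF l y u] Q_mat_bg_mat[OF u] by simp
  then have "matrix_inv (bg_mat \<gamma> f0 u l) ** Q_mat \<gamma> f0 f u l ** bg_mat \<gamma> f0 u l =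
      matrix_inv (bg_mat \<gamma> f0 u l) ** bg_mat \<gamma> f0 u l ** K_mat f u l"
    by (simp add: matrix_mul_assoc[symmetric])
  then show ?thesis using matrix_inv_mult_self[OF inv] by simp
qed

text \<open>The first conjunct states that generically no denominator vanishes and the inverse is
  genuine, so the equality in the second is not an artefact of default values.\<close>

theorem mainTheorem4:
  fixes f :: "complex ^ 'n::{finite,linorder} \<Rightarrow> complex"
    and \<gamma> f0 :: complex
  assumes "CARD('n) \<ge> 2"
    and "\<gamma> \<noteq> 0"
    and "meromorphic_sv f"
    and "\<And>i. meromorphic_eq (\<lambda>l. f (l + axis i \<gamma>)) f"
    and "\<not> meromorphic_eq f (\<lambda>l. 0)"
  shows "generically (joint (\<lambda>u l.
             u \<noteq> 0 \<and> sigma l + (u - \<gamma>) + f0 \<noteq> 0 \<and>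
             (\<forall>i j. i \<noteq> j \<longrightarrow> l $ i - l $ j \<noteq> 0) \<and>
             (\<forall>i j. f l - (l $ i - l $ j) \<noteq> 0) \<and>
             invertible (bg_mat \<gamma> f0 u l)))
       \<and> (\<forall>i j. meromorphic_eq
             (joint (\<lambda>u l. K_mat f u l $ i $ j))
             (joint (\<lambda>u l. (matrix_inv (bg_mat \<gamma> f0 u l) ** Q_mat \<gamma> f0 f u l
                              ** bg_mat \<gamma> f0 u l) $ i $ j)))"
proof -
  let ?b = "\<lambda>u l. bg_mat \<gamma> f0 u l"
  let ?reg = "\<lambda>u l. u \<noteq> 0 \<and> sigma l + (u - \<gamma>) + f0 \<noteq> 0 \<and> (\<forall>i j. i \<noteq> j \<longrightarrow> l $ i - l $ j \<noteq> 0) \<and>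
     (\<forall>i j. f l - (l $ i - l $ j) \<noteq> 0)"
  have reg: "generically (joint ?reg)"
    by (rule generically_regular[OF assms(2-5)])
  have inj: "inj (($) l)" if "?reg u l" for u l
    using that by (auto simp: inj_def)
  have inv: "invertible (?b u l)" if "?reg u l" for u l
    by (rule invertible_bg_mat[OF inj[OF that]]) (use that in auto)
  have eq: "K_mat f u l = matrix_inv (?b u l) ** Q_mat \<gamma> f0 f u l ** ?b u l" if "?reg u l" for u l
    by (rule K_mat_factorization[OF inj[OF that] _ _ inv[OF that]]) (use that in auto)
  have "generically (joint (\<lambda>u l.
             u \<noteq> 0 \<and> sigma l + (u - \<gamma>) + f0 \<noteq> 0 \<and>
             (\<forall>i j. i \<noteq> j \<longrightarrow> l $ i - l $ j \<noteq> 0) \<and>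
             (\<forall>i j. f l - (l $ i - l $ j) \<noteq> 0) \<and>
             invertible (?b u l)))"
    using reg by (rule generically_mono) (simp add: joint_def inv)
  moreover have "meromorphic_eq (joint (\<lambda>u l. K_mat f u l $ i $ j))
      (joint (\<lambda>u l. (matrix_inv (?b u l) ** Q_mat \<gamma> f0 f u l ** ?b u l) $ i $ j))" for i j
  proof -
    have "generically (\<lambda>z. joint (\<lambda>u l. K_mat f u l $ i $ j) z =
        joint (\<lambda>u l. (matrix_inv (?b u l) ** Q_mat \<gamma> f0 f u l ** ?b u l) $ i $ j) z)"
      using reg by (rule generically_mono) (unfold joint_def, drule eq, simp only:)
    \<comment> \<open>Meromorphy of the right side is inherited from \<open>K\<close> through
      generic equality.\<close>
    with meromorphic_sv_K_mat[OF assms(3), of i j] show ?thesis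
      unfolding meromorphic_eq_def by (blast intro: meromorphic_sv_generically_eq)
  qed
  ultimately show ?thesis by blast
qed

end
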